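(* Let $N\ge2$ be an integer and let $f\in C(\mathbb{R},\mathbb{R})$, $F(t)=\int_0^tf(\tau)\,d\tau$, satisfy $\lim_{t\to0}f(t)/t=0$ and $\lim_{t\to0}\frac{F(t)}{|t|^{2+\frac4N}}=+\infty$. For $m>0$ let $S_m$, $I$ and $E_m=\inf_{u\in S_m}I(u)$ be as defined in the context. Then $0>E_m>-\infty$ for every $m>0$, and the mapping $m\mapsto E_m$ is strictly decreasing and continuous on $(0,+\infty)$. Moreover, if in addition $F(t)\le F(|t|)$ for all $t\in\mathbb{R}$, then for all $m>0$ the infimum $E_m$ is achieved by some positive Schwarz symmetric function $u\in S_m$ (that is, $I(u)=E_m$, $u(x)>0$ for all $x\in\mathbb{Z}^N$, and $u$ is Schwarz symmetric).
   Context: The lattice graph $\mathbb{Z}^N$ has vertex set $\{x=(x_1,\dots,x_N):x_i\in\mathbb{Z}\}$, and $x\sim y$ means $\sum_{i=1}^N|x_i-y_i|=1$. $\mu$ is the counting measure on $\mathbb{Z}^N$, so $\int_{\mathbb{Z}^N} g\,d\mu=\sum_{x\in\mathbb{Z}^N}g(x)$. $\ell^p(\mathbb{Z}^N)$ has its usual norm $\|\cdot\|_p$. For $u:\mathbb{Z}^N\to\mathbb{R}$, $$|\nabla u|(x)=\Big(\tfrac12\sum_{y\sim x}(u(y)-u(x))^2\Big)^{1/2}.$$ $H^1(\mathbb{Z}^N)$ is the completion of the finitely supported functions under the norm $\big(\tfrac12\sum_x\sum_{y\sim x}(u(y)-u(x))^2+\sum_x u(x)^2\big)^{1/2}$; it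 coincides with $\ell^2(\mathbb{Z}^N)$ with equivalent norms. For $m>0$, $S_m=\{u\in H^1(\mathbb{Z}^N):\|u\|_2^2=m\}$. The functional is $$I(u)=\frac12\int_{\mathbb{Z}^N}|\nabla u|^2\,d\mu-\int_{\mathbb{Z}^N}F(u)\,d\mu,\qquad u\in H^1(\mathbb{Z}^N),$$ and $E_m=\inf_{u\in S_m}I(u)$. Schwarz symmetry. Let $C_0^+(\mathbb{Z}^N)$ be the set of admissible functions, i.e. functions $u:\mathbb{Z}^N\to[0,\infty)$ such that $\{x:u(x)>t\}$ is finite for every $t>0$. Let $R=R_{\mathbb{Z}^N}:C_0^+(\mathbb{Z}^N)\to C_0^+(\mathbb{Z}^N)$ denote the discrete Schwarz rearrangement operator on $\mathbb{Z}^N$ of Hajaiej, Han and Hua. A function $u\in C_0^+(\mathbb{Z}^N)$ is called Schwarz symmetric if $Ru=u$; $\mathcal{S}(\mathbb{Z}^N)$ denotes the set of Schwarz symmetric functions and $\mathcal{S}^p(\mathbb{Z}^N)=\mathcal{S}(\mathbb{Z}^N)\cap\ell^p(\mathbb{Z}^N)$. For the present purpose, $R$ is specified by the following known properties, which may be taken as given: (a) $R(Ru)=Ru$ for all $u\in C_0^+(\mathbb{Z}^N)$; (b) for every $g:[0,\infty)\to[0,\infty)$ with $g(0)=0$ and every $u\in C_0^+(\mathbb{Z}^N)$, $\sum_x g(u(x))=\sum_x g(Ru(x))$; (c) for every non-negative $u\in\ell^2(\mathbb{Z}^N)$, $\|\nabla (Ru)\|_2\le\|\nabla u\|_2$; (d)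 if $u_n\in\mathcal{S}(\mathbb{Z}^N)$ converge pointwise to $u\in C_0^+(\mathbb{Z}^N)$, then $u\in\mathcal{S}(\mathbb{Z}^N)$; (e) for $1\le p<q<\infty$, every bounded sequence in $\mathcal{S}^p(\mathbb{Z}^N)$ (bounded in $\ell^p$) has a subsequence converging in $\ell^q(\mathbb{Z}^N)$. *)

theory Defs
  imports "HOL-Analysis.Analysis"
begin

section \<open>The lattice graph\<close>

type_synonym 'n lattice = "int ^ 'n"

definition adjacent :: "'n::finite lattice \<Rightarrow> 'n lattice \<Rightarrow> bool" where
  "adjacent x y \<longleftrightarrow> (\<Sum>i\<in>UNIV. \<bar>x $ i - y $ i\<bar>) = 1"

text \<open>Finiteness of neighbourhoods, so that the finite sums over neighbours below are meaningful
  (\<^const>\<open>sum\<close> over an infinite set would be 0).\<close>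

lemma finite_neighbours: "finite {y. adjacent x (y :: 'n::finite lattice)}"
proof -
  let ?B = "\<Union>i. {x $ i - 1 .. x $ i + 1}"
  have "y $ i \<in> {x $ i - 1 .. x $ i + 1}" if "adjacent x y" for y i
  proof -
    have "\<bar>x $ i - y $ i\<bar> \<le> (\<Sum>i\<in>UNIV. \<bar>x $ i - y $ i\<bar>)"
      by (rule member_le_sum) auto
    with that show ?thesis by (auto simp: adjacent_def)
  qed
  then have "($) ` {y. adjacent x y} \<subseteq> {g. \<forall>i. g i \<in> ?B}" by blast
  moreover have "finite {g :: 'n \<Rightarrow> int. \<forall>i. g i \<in> ?B}"
    using finite_set_of_finite_funs[of "UNIV :: 'n set" ?B undefined] by simp
  ultimately have "finite (($) ` {y. adjacent x y})" by (rule finite_subset)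
  then show ?thesis
    by (rule finite_imageD) (auto intro!: inj_onI simp: vec_eq_iff)
qed


section \<open>Function spaces\<close>

definition lp :: "real \<Rightarrow> ('a \<Rightarrow> real) set" where
  "lp p = {u. (\<lambda>x. \<bar>u x\<bar> powr p) summable_on UNIV}"

definition lp_norm :: "real \<Rightarrow> ('a \<Rightarrow> real) \<Rightarrow> real" where
  "lp_norm p u = (\<Sum>\<^sub>\<infinity>x. \<bar>u x\<bar> powr p) powr (1 / p)"

definition grad_norm :: "('n::finite lattice \<Rightarrow> real) \<Rightarrow> 'n lattice \<Rightarrow> real" where
  "grad_norm u x = sqrt ((1 / 2) * (\<Sum>y | adjacent x y. (u y - u x)\<^sup>2))"

definition finitely_supported :: "('a \<Rightarrow> real) \<Rightarrow> bool" where
  "finitely_supported u \<longleftrightarrow> finite {x. u x \<noteq> 0}"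

definition H1_norm :: "('n::finite lattice \<Rightarrow> real) \<Rightarrow> real" where
  "H1_norm u = sqrt ((1 / 2) * (\<Sum>\<^sub>\<infinity>x. \<Sum>y | adjacent x y. (u y - u x)\<^sup>2) + (\<Sum>\<^sub>\<infinity>x. (u x)\<^sup>2))"

text \<open>The completion of the finitely supported functions under \<^const>\<open>H1_norm\<close>, realised as a
  space of functions. The norm dominates every point evaluation, so a Cauchy sequence has a
  pointwise limit, and this limit represents the class of the sequence in the completion.\<close>

definition H1 :: "('n::finite lattice \<Rightarrow> real) set" where
  "H1 = {u. \<exists>\<phi> :: nat \<Rightarrow> 'n lattice \<Rightarrow> real.
           (\<forall>n. finitely_supported (\<phi> n)) \<and>
           (\<forall>e>0. \<exists>M. \<forall>j\<ge>M. \<forall>k\<ge>M. H1_norm (\<lambda>x. \<phi> j x - \<phi> k x) < e) \<and>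
           (\<forall>x. (\<lambda>n. \<phi> n x) \<longlonglongrightarrow> u x)}"


section \<open>The constrained variational problem\<close>

text \<open>The interval integral is oriented, so this is also the intended value for negative t.\<close>

definition primitive :: "(real \<Rightarrow> real) \<Rightarrow> real \<Rightarrow> real" where
  "primitive f t = (LBINT \<tau>=ereal 0..ereal t. f \<tau>)"

definition mass_sphere :: "real \<Rightarrow> ('n::finite lattice \<Rightarrow> real) set" where
  "mass_sphere m = {u \<in> H1. (lp_norm 2 u)\<^sup>2 = m}"

definition energy :: "(real \<Rightarrow> real) \<Rightarrow> ('n::finite lattice \<Rightarrow> real) \<Rightarrow> real" where
  "energy f u = (1 / 2) * (\<Sum>\<^sub>\<infinity>x. (grad_norm u x)\<^sup>2) - (\<Sum>\<^sub>\<infinity>x. primitive f (u x))"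

text \<open>The infimum is taken in the extended reals, so that its finiteness can be stated. The
  first argument only fixes the dimension of the lattice.\<close>

definition min_energy :: "'n::finite itself \<Rightarrow> (real \<Rightarrow> real) \<Rightarrow> real \<Rightarrow> ereal" where
  "min_energy _ f m = (INF u \<in> (mass_sphere m :: ('n lattice \<Rightarrow> real) set). ereal (energy f u))"


section \<open>Schwarz symmetry\<close>

definition admissible :: "('a \<Rightarrow> real) \<Rightarrow> bool" where
  "admissible u \<longleftrightarrow> (\<forall>x. u x \<ge> 0) \<and> (\<forall>t>0. finite {x. u x > t})"

definition schwarz_symmetric ::
  "(('n::finite lattice \<Rightarrow> real) \<Rightarrow> 'n lattice \<Rightarrow> real) \<Rightarrow> ('n lattice \<Rightarrow> real) \<Rightarrow> bool" where
  "schwarz_symmetric R u \<longleftrightarrow> admissible u \<and> R u = u"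

text \<open>The properties specifying the discrete Schwarz rearrangement operator of Hajaiej, Han and Hua.
  The values of R on non-admissible functions are irrelevant. The sums in the equimeasurability
  property may diverge and are therefore taken in \<^typ>\<open>ennreal\<close>.\<close>

locale schwarz_rearrangement =
  fixes R :: "('n::finite lattice \<Rightarrow> real) \<Rightarrow> 'n lattice \<Rightarrow> real"
  assumes maps_admissible: "admissible u \<Longrightarrow> admissible (R u)"
    and idempotent: "admissible u \<Longrightarrow> R (R u) = R u"
    and equimeasurable:
      "\<lbrakk>g 0 = 0; \<forall>t\<ge>0. g t \<ge> 0; admissible u\<rbrakk> \<Longrightarrow>
        (\<Sum>\<^sub>\<infinity>x. ennreal (g (u x))) = (\<Sum>\<^sub>\<infinity>x. ennreal (g (R u x)))"
    and polya_szego: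
      "\<lbrakk>u \<in> lp 2; \<forall>x. u x \<ge> 0\<rbrakk> \<Longrightarrow> lp_norm 2 (grad_norm (R u)) \<le> lp_norm 2 (grad_norm u)"
    and closed_pointwise:
      "\<lbrakk>\<forall>n. schwarz_symmetric R (v n); admissible u; \<forall>x. (\<lambda>n. v n x) \<longlonglongrightarrow> u x\<rbrakk> \<Longrightarrow>
        schwarz_symmetric R u"
    and compact_embedding:
      "\<lbrakk>1 \<le> p; p < q; \<forall>n. schwarz_symmetric R (v n) \<and> v n \<in> lp p; \<forall>n. lp_norm p (v n) \<le> C\<rbrakk> \<Longrightarrow>
        \<exists>(r :: nat \<Rightarrow> nat) w. strict_mono r \<and> w \<in> lp q \<and>
          (\<lambda>n. lp_norm q (\<lambda>x. v (r n) x - w x)) \<longlonglongrightarrow> 0"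

end

theory Submission
  imports Defs
begin

text \<open>Spread-out cones of mass \<open>m\<close> have negative energy, because \<open>F\<close> dominates the critical power
  \<open>2 + 4 / N\<close> near 0. Finitely supported functions are dense on the sphere of mass \<open>m\<close> and can be
  translated far apart, so the minimal energy satisfies \<open>E (m + n) \<le> E m + E n\<close>; with \<open>E n < 0\<close> it is
  strictly decreasing. Scaling a function changes its energy by at most a multiple of the change of
  mass, so \<open>E\<close> is locally Lipschitz. A minimizing sequence, rearranged, has a subsequence converging in
  the 4-norm, hence uniformly. The limit has mass at most \<open>m\<close> and energy at most \<open>E m\<close>, and strict
  monotonicity forces its mass to be \<open>m\<close>. A zero of the minimizer could be raised slightly, with a
  gain of first order and costs of second order only.\<close>

section \<open>Unordered sums of real functions\<close>

lemma summable_on_real_comparison: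
  fixes f g :: "'a \<Rightarrow> real"
  assumes "g summable_on A" "\<And>x. x \<in> A \<Longrightarrow> \<bar>f x\<bar> \<le> g x"
  shows "f summable_on A"
  unfolding summable_on_iff_abs_summable_on_real[of f A]
  by (rule Infinite_Sum.abs_summable_on_comparison_test'[OF assms(1)]) (simp add: assms(2))

lemma has_sum_sum_finite:
  fixes f :: "'i \<Rightarrow> 'a \<Rightarrow> real"
  assumes "finite I" "\<And>i. i \<in> I \<Longrightarrow> (f i has_sum s i) A"
  shows "((\<lambda>x. \<Sum>i\<in>I. f i x) has_sum (\<Sum>i\<in>I. s i)) A"
  using assms by (induction I) (auto intro!: has_sum_add)

lemma nonneg_summable_on_bounded:
  fixes f :: "'a \<Rightarrow> real"
  assumes "\<And>x. x \<in> A \<Longrightarrow> f x \<ge> 0" "\<And>S. finite S \<Longrightarrow> S \<subseteq> A \<Longrightarrow> sum f S \<le> c"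
  shows "f summable_on A" "infsum f A \<le> c"
proof -
  show "f summable_on A"
    by (rule nonneg_bdd_above_summable_on) (use assms in \<open>auto intro!: bdd_aboveI[where M = c]\<close>)
  then show "infsum f A \<le> c"
    by (rule infsum_le_finite_sums) (use assms in auto)
qed

text \<open>Fatou's lemma for counting measure: each finite partial sum passes to the limit, and a
  non-negative sum is the supremum of its finite partial sums. The bounds \<open>c n\<close> may
  vary, so that energies tending to the infimum can be inserted directly.\<close>

lemma infsum_fatou:
  fixes g :: "nat \<Rightarrow> 'a \<Rightarrow> real"
  assumes lim: "\<And>x. (\<lambda>n. g n x) \<longlonglongrightarrow> h x"
    and nonneg: "\<And>n x. g n x \<ge> 0"
    and sm: "\<And>n. g n summable_on UNIV"
    and le: "\<And>n. infsum (g n) UNIV \<le> c n" and c: "c \<longlonglongrightarrow> C"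
  shows "h summable_on UNIV" "infsum h UNIV \<le> C"
proof -
  have "h x \<ge> 0" for x
    by (rule LIMSEQ_le_const[OF lim]) (use nonneg in auto)
  moreover have "sum h S \<le> C" if "finite S" for S
  proof (rule LIMSEQ_le[OF _ c])
    show "(\<lambda>n. sum (g n) S) \<longlonglongrightarrow> sum h S"
      by (intro tendsto_sum lim)
    have "sum (g n) S \<le> c n" for n
      using finite_sum_le_infsum[OF sm, of S n] that nonneg le[of n] by force
    then show "\<exists>N. \<forall>n\<ge>N. sum (g n) S \<le> c n" by blast
  qed
  ultimately show "h summable_on UNIV" "infsum h UNIV \<le> C"
    using nonneg_summable_on_bounded[of UNIV h C] by auto
qed

lemma infsum_diff_real:
  fixes f g :: "'a \<Rightarrow> real"
  assumes "f summable_on A" "g summable_on A"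
  shows "(\<Sum>\<^sub>\<infinity>x\<in>A. f x - g x) = infsum f A - infsum g A"
  using has_sum_add[OF has_sum_infsum[OF assms(1)] has_sum_uminusI[OF has_sum_infsum[OF assms(2)]]]
  by (simp add: infsumI)

lemma abs_infsum_diff_le:
  fixes f g h :: "'a \<Rightarrow> real"
  assumes "f summable_on A" "g summable_on A" "h summable_on A"
    "\<And>x. x \<in> A \<Longrightarrow> \<bar>f x - g x\<bar> \<le> h x"
  shows "\<bar>infsum f A - infsum g A\<bar> \<le> infsum h A"
proof -
  have "f x \<le> g x + h x" "g x \<le> f x + h x" if "x \<in> A" for x
    using assms(4)[OF that] by auto
  then have "infsum f A \<le> infsum (\<lambda>x. g x + h x) A" "infsum g A \<le> infsum (\<lambda>x. f x + h x) A"
    using assms(1-3) by (auto intro!: infsum_mono summable_on_add)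
  then show ?thesis
    using assms(1-3) by (auto simp: infsum_add)
qed

lemma infsum_change_finite:
  fixes f g :: "'a \<Rightarrow> real"
  assumes "f summable_on UNIV" "finite S" "\<And>x. x \<notin> S \<Longrightarrow> g x = f x"
  shows "g summable_on UNIV" "infsum g UNIV = infsum f UNIV + (\<Sum>x\<in>S. g x - f x)"
proof -
  have "((\<lambda>x. g x - f x) has_sum (\<Sum>x\<in>S. g x - f x)) UNIV"
    by (rule has_sum_finite_neutralI[OF assms(2)]) (use assms(3) in auto)
  from has_sum_add[OF has_sum_infsum[OF assms(1)] this]
  have "(g has_sum infsum f UNIV + (\<Sum>x\<in>S. g x - f x)) UNIV" by simp
  then show "g summable_on UNIV" "infsum g UNIV = infsum f UNIV + (\<Sum>x\<in>S. g x - f x)"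
    by (auto simp: has_sum_iff)
qed

lemma infsum_ennreal:
  fixes g :: "'a \<Rightarrow> real"
  assumes "g summable_on A" "\<And>x. g x \<ge> 0"
  shows "(\<Sum>\<^sub>\<infinity>x\<in>A. ennreal (g x)) = ennreal (infsum g A)"
proof -
  have "sum (ennreal \<circ> g) S = ennreal (sum g S)" for S
    using sum_ennreal[of S g] assms(2) by simp
  then have "infsum (ennreal \<circ> g) A = ennreal (infsum g A)"
    by (intro infsum_comm_additive_general) (auto simp: assms)
  then show ?thesis by (simp add: comp_def)
qed

text \<open>A real \<open>infsum\<close> is 0 by default where it diverges, so summability after
  rearrangement cannot be read off from a real sum; it comes from finiteness of the
  \<open>ennreal\<close> sum.\<close>

lemma summable_on_ennreal_bounded:
  fixes g :: "'a \<Rightarrow> real"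
  assumes "(\<Sum>\<^sub>\<infinity>x\<in>A. ennreal (g x)) = ennreal c" "c \<ge> 0" "\<And>x. g x \<ge> 0"
  shows "g summable_on A"
proof (rule nonneg_summable_on_bounded(1))
  fix S assume S: "finite S" "S \<subseteq> A"
  have "ennreal (sum g S) = (\<Sum>\<^sub>\<infinity>x\<in>S. ennreal (g x))"
    using S assms(3) by (simp add: sum_ennreal)
  also have "\<dots> \<le> (\<Sum>\<^sub>\<infinity>x\<in>A. ennreal (g x))"
    by (rule infsum_mono_neutral) (use S in \<open>auto intro: nonneg_summable_on_complete\<close>)
  finally show "sum g S \<le> c" using assms(1,2) by simp
qed (rule assms(3))

lemma uniform_limit_pointwise:
  fixes v :: "nat \<Rightarrow> 'a \<Rightarrow> real"
  assumes "\<And>e. e > 0 \<Longrightarrow> \<forall>\<^sub>F n in sequentially. \<forall>x. \<bar>v n x - w x\<bar> \<le> e"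
  shows "(\<lambda>n. v n x) \<longlonglongrightarrow> w x"
proof (rule LIMSEQ_I)
  fix e :: real assume "e > 0"
  then have "\<forall>\<^sub>F n in sequentially. \<forall>x. \<bar>v n x - w x\<bar> \<le> e / 2" by (intro assms) simp
  then obtain N where "\<And>n. n \<ge> N \<Longrightarrow> \<bar>v n x - w x\<bar> \<le> e / 2"
    unfolding eventually_sequentially by blast
  with \<open>e > 0\<close> show "\<exists>N. \<forall>n\<ge>N. norm (v n x - w x) < e"
    by (intro exI[of _ N]) fastforce
qed


section \<open>Square-summable functions\<close>

definition square_summable :: "('a \<Rightarrow> real) \<Rightarrow> bool" where
  "square_summable u \<longleftrightarrow> (\<lambda>x. (u x)\<^sup>2) summable_on UNIV"

definition mass :: "('a \<Rightarrow> real) \<Rightarrow> real" where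
  "mass u = (\<Sum>\<^sub>\<infinity>x. (u x)\<^sup>2)"

lemma mass_nonneg: "mass u \<ge> 0"
  unfolding mass_def by (rule infsum_nonneg) auto

lemma sum_le_mass:
  assumes "square_summable u" "finite S"
  shows "(\<Sum>x\<in>S. (u x)\<^sup>2) \<le> mass u"
  unfolding mass_def using assms
  by (intro finite_sum_le_infsum) (auto simp: square_summable_def)

text \<open>The embedding into bounded functions, available because points have measure 1. It makes
  the behaviour of \<open>F\<close> outside a bounded interval irrelevant on each sphere.\<close>

lemma abs_le_sqrt_mass:
  assumes "square_summable u"
  shows "\<bar>u x\<bar> \<le> sqrt (mass u)"
  using sum_le_mass[OF assms, of "{x}"] by (intro real_le_rsqrt) auto

lemma mass_zero: "mass (\<lambda>_. 0) = 0"
  by (simp add: mass_def)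

lemma square_summable_comparison:
  assumes "square_summable v" "\<And>x. \<bar>u x\<bar> \<le> \<bar>v x\<bar>"
  shows "square_summable u" "mass u \<le> mass v"
proof -
  have *: "(u x)\<^sup>2 \<le> (v x)\<^sup>2" for x
    using assms(2)[of x] by (simp add: abs_le_square_iff)
  show "square_summable u"
    unfolding square_summable_def
    by (rule summable_on_real_comparison[of "\<lambda>x. (v x)\<^sup>2"])
       (use * assms(1) in \<open>auto simp: square_summable_def\<close>)
  then show "mass u \<le> mass v"
    unfolding mass_def by (intro infsum_mono) (use * assms(1) in \<open>auto simp: square_summable_def\<close>)
qed

lemma square_summable_cmult:
  assumes "square_summable u" shows "square_summable (\<lambda>x. c * u x)"
  using assms by (auto simp: square_summable_def power_mult_distrib intro: summable_on_cmult_right)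

lemma mass_cmult: "mass (\<lambda>x. c * u x) = c\<^sup>2 * mass u"
  by (simp add: mass_def power_mult_distrib infsum_cmult_right')

lemma square_summable_diff:
  assumes "square_summable u" "square_summable v"
  shows "square_summable (\<lambda>x. u x - v x)" "mass (\<lambda>x. u x - v x) \<le> 2 * mass u + 2 * mass v"
proof -
  have *: "(u x - v x)\<^sup>2 \<le> 2 * (u x)\<^sup>2 + 2 * (v x)\<^sup>2" for x
    using zero_le_power2[of "u x + v x"] by (simp add: power2_eq_square algebra_simps)
  have s: "(\<lambda>x. 2 * (u x)\<^sup>2) summable_on UNIV" "(\<lambda>x. 2 * (v x)\<^sup>2) summable_on UNIV"
    using assms by (auto simp: square_summable_def intro: summable_on_cmult_right)
  then have s': "(\<lambda>x. 2 * (u x)\<^sup>2 + 2 * (v x)\<^sup>2) summable_on UNIV"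
    by (rule summable_on_add)
  show ss: "square_summable (\<lambda>x. u x - v x)"
    unfolding square_summable_def
    by (rule summable_on_real_comparison[OF s']) (use * in auto)
  have "mass (\<lambda>x. u x - v x) \<le> (\<Sum>\<^sub>\<infinity>x. 2 * (u x)\<^sup>2 + 2 * (v x)\<^sup>2)"
    unfolding mass_def by (rule infsum_mono) (use ss s' * in \<open>auto simp: square_summable_def\<close>)
  also have "\<dots> = 2 * mass u + 2 * mass v"
    by (subst infsum_add[OF s]) (simp add: mass_def infsum_cmult_right')
  finally show "mass (\<lambda>x. u x - v x) \<le> 2 * mass u + 2 * mass v" .
qed

lemma bij_shift: "bij (\<lambda>x. x + e :: 'a::group_add)"
  by (rule bij_betw_byWitness[where f' = "\<lambda>x. x - e"]) auto

lemma square_summable_shift: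
  assumes "square_summable u" shows "square_summable (\<lambda>x. u (x + e :: 'a::group_add))"
  using assms summable_on_reindex_bij_betw[OF bij_shift, of "\<lambda>x. (u x)\<^sup>2" e]
  by (simp add: square_summable_def)

lemma mass_shift: "mass (\<lambda>x. u (x + e :: 'a::group_add)) = mass u"
  using infsum_reindex_bij_betw[OF bij_shift, of "\<lambda>x. (u x)\<^sup>2" e]
  by (simp add: mass_def)

lemma square_summable_finitely_supported:
  assumes "finitely_supported u" shows "square_summable u"
  unfolding square_summable_def
  by (rule finite_nonzero_values_imp_summable_on) (use assms in \<open>simp add: finitely_supported_def\<close>)

lemma mass_finitely_supported:
  assumes "finite S" "\<And>x. x \<notin> S \<Longrightarrow> u x = 0"
  shows "mass u = (\<Sum>x\<in>S. (u x)\<^sup>2)"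
  unfolding mass_def using assms
  by (subst infsum_cong_neutral[of _ UNIV _ "\<lambda>x. (u x)\<^sup>2"]) (auto simp flip: infsum_finite)

lemma mass_eq_0D:
  assumes "square_summable u" "mass u = 0" shows "u = (\<lambda>_. 0)"
  using abs_le_sqrt_mass[OF assms(1)] assms(2) by auto

text \<open>Chebyshev's argument: \<open>n\<close> points with values above \<open>t\<close> already
  contribute \<open>n * t\<^sup>2\<close> to the mass.\<close>

lemma finite_superlevel:
  assumes "square_summable u" "t > 0" shows "finite {x. \<bar>u x\<bar> > t}"
proof (rule ccontr)
  assume inf: "infinite {x. \<bar>u x\<bar> > t}"
  obtain n where n: "mass u < real n * t\<^sup>2"
    using reals_Archimedean3[of "t\<^sup>2"] assms(2) by auto
  obtain S where S: "finite S" "card S = n" "S \<subseteq> {x. \<bar>u x\<bar> > t}"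
    using infinite_arbitrarily_large[OF inf, of n] by auto
  have "(\<Sum>x\<in>S. t\<^sup>2) \<le> (\<Sum>x\<in>S. (u x)\<^sup>2)"
    using S(3) assms(2) by (intro sum_mono) (auto simp flip: abs_le_square_iff)
  with n S(2) sum_le_mass[OF assms(1) S(1)] show False by simp
qed

lemma mass_update:
  assumes "square_summable u"
  shows "square_summable (u(a := c))" "mass (u(a := c)) = mass u - (u a)\<^sup>2 + c\<^sup>2"
  using infsum_change_finite[of "\<lambda>x. (u x)\<^sup>2" "{a}" "\<lambda>x. ((u(a := c)) x)\<^sup>2"] assms
  by (auto simp: square_summable_def mass_def)

definition truncate :: "'a set \<Rightarrow> ('a \<Rightarrow> real) \<Rightarrow> 'a \<Rightarrow> real" where
  "truncate S u x = (if x \<in> S then u x else 0)"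

lemma truncate_mass:
  assumes "square_summable u" "finite S"
  shows "square_summable (truncate S u)" "square_summable (\<lambda>x. u x - truncate S u x)"
    "mass (truncate S u) = (\<Sum>x\<in>S. (u x)\<^sup>2)"
    "mass (\<lambda>x. u x - truncate S u x) = mass u - (\<Sum>x\<in>S. (u x)\<^sup>2)"
proof -
  show 1: "square_summable (truncate S u)"
    by (rule square_summable_comparison[OF assms(1)]) (auto simp: truncate_def)
  show 2: "square_summable (\<lambda>x. u x - truncate S u x)"
    by (rule square_summable_comparison[OF assms(1)]) (auto simp: truncate_def)
  show 3: "mass (truncate S u) = (\<Sum>x\<in>S. (u x)\<^sup>2)"
    using mass_finitely_supported[OF assms(2), of "truncate S u"]
    by (simp add: truncate_def)
  have "mass u = (\<Sum>\<^sub>\<infinity>x. (truncate S u x)\<^sup>2 + (u x - truncate S u x)\<^sup>2)"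
    unfolding mass_def by (rule infsum_cong) (auto simp: truncate_def)
  also have "\<dots> = mass (truncate S u) + mass (\<lambda>x. u x - truncate S u x)"
    unfolding mass_def using 1 2 by (intro infsum_add) (auto simp: square_summable_def)
  finally show "mass (\<lambda>x. u x - truncate S u x) = mass u - (\<Sum>x\<in>S. (u x)\<^sup>2)"
    using 3 by simp
qed

lemma mass_approx:
  assumes "square_summable u" "e > 0"
  obtains S where "finite S" "mass u - e < (\<Sum>x\<in>S. (u x)\<^sup>2)" "(\<Sum>x\<in>S. (u x)\<^sup>2) \<le> mass u"
proof -
  obtain S where "finite S" "dist (\<Sum>x\<in>S. (u x)\<^sup>2) (mass u) \<le> e / 2"
    using infsum_finite_approximation[of "\<lambda>x. (u x)\<^sup>2" UNIV "e/2"] assms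
    by (auto simp: square_summable_def mass_def)
  with sum_le_mass[OF assms(1)] show thesis
    using assms(2) by (intro that[of S]) (auto simp: dist_real_def)
qed

text \<open>Young's inequality with parameter replaces the triangle inequality of the 2-norm, so that
  no square roots have to be handled.\<close>

lemma mass_young:
  assumes "square_summable u" "square_summable v" "e > 0"
  shows "mass v \<le> (1 + e) * mass u + (1 + 1 / e) * mass (\<lambda>x. u x - v x)"
proof -
  have *: "(v x)\<^sup>2 \<le> (1 + e) * (u x)\<^sup>2 + (1 + 1 / e) * (u x - v x)\<^sup>2" for x
  proof -
    \<comment> \<open>Write \<open>v x\<close> as \<open>u x - (u x - v x)\<close> and expand its
      square: non-negativity of this expression bounds the cross term.\<close>
    have "0 \<le> (e * u x + (u x - v x))\<^sup>2 / e" using assms by simp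
    also have "\<dots> = (1 + e) * (u x)\<^sup>2 + (1 + 1 / e) * (u x - v x)\<^sup>2 - (v x)\<^sup>2"
      using assms(3) by (simp add: field_simps power2_eq_square)
    finally show ?thesis by simp
  qed
  have s: "(\<lambda>x. (1 + e) * (u x)\<^sup>2) summable_on UNIV"
    "(\<lambda>x. (1 + 1 / e) * (u x - v x)\<^sup>2) summable_on UNIV"
    using assms square_summable_diff(1)[OF assms(1,2)]
    by (auto simp: square_summable_def intro: summable_on_cmult_right)
  have "mass v \<le> (\<Sum>\<^sub>\<infinity>x. (1 + e) * (u x)\<^sup>2 + (1 + 1 / e) * (u x - v x)\<^sup>2)"
    unfolding mass_def
    by (rule infsum_mono) (use assms s * in \<open>auto simp: square_summable_def intro: summable_on_add\<close>)
  also have "\<dots> = (1 + e) * mass u + (1 + 1 / e) * mass (\<lambda>x. u x - v x)"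
    by (subst infsum_add[OF s]) (simp add: mass_def infsum_cmult_right')
  finally show ?thesis .
qed


section \<open>The Dirichlet form\<close>

definition unit_steps :: "'n::finite lattice set" where
  "unit_steps = {e. adjacent 0 e}"

lemma finite_unit_steps: "finite unit_steps"
  unfolding unit_steps_def by (rule finite_neighbours)

lemma zero_notin_unit_steps: "0 \<notin> unit_steps"
  by (simp add: unit_steps_def adjacent_def)

lemma adjacent_iff_unit_steps: "adjacent x y \<longleftrightarrow> y - x \<in> unit_steps"
  by (simp add: unit_steps_def adjacent_def abs_minus_commute)

lemma sum_neighbours: "(\<Sum>y | adjacent x y. g y) = (\<Sum>e\<in>unit_steps. g (x + e))"
  by (rule sum.reindex_bij_witness[where i = "\<lambda>e. x + e" and j = "\<lambda>y. y - x"])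
     (auto simp: adjacent_iff_unit_steps)

text \<open>The full integral of the squared gradient; the factor 1/2 is the one in
  \<open>grad_norm\<close>, and \<open>J\<close> halves it once more. Summing direction by direction
  makes each term the mass of a difference, so facts about \<open>mass\<close> carry over
  termwise.\<close>

definition dirichlet :: "('n::finite lattice \<Rightarrow> real) \<Rightarrow> real" where
  "dirichlet u = (1 / 2) * (\<Sum>e\<in>unit_steps. mass (\<lambda>x. u (x + e) - u x))"

lemma dirichlet_nonneg: "dirichlet u \<ge> 0"
  unfolding dirichlet_def by (intro mult_nonneg_nonneg sum_nonneg mass_nonneg) auto

lemma square_summable_step:
  assumes "square_summable u" shows "square_summable (\<lambda>x. u (x + e) - u (x :: 'a::group_add))"
  by (intro square_summable_diff square_summable_shift assms)

lemma dirichlet_has_sum: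
  assumes "square_summable u"
  shows "((\<lambda>x. \<Sum>y | adjacent x y. (u y - u x)\<^sup>2) has_sum 2 * dirichlet u) UNIV"
proof -
  have "((\<lambda>x. \<Sum>e\<in>unit_steps. (u (x + e) - u x)\<^sup>2) has_sum
      (\<Sum>e\<in>unit_steps. mass (\<lambda>x. u (x + e) - u x))) UNIV"
    using square_summable_step[OF assms]
    by (intro has_sum_sum_finite finite_unit_steps)
       (auto simp: mass_def square_summable_def intro: has_sum_infsum)
  then show ?thesis by (simp add: sum_neighbours dirichlet_def)
qed

lemma grad_norm_power2: "(grad_norm u x)\<^sup>2 = (1 / 2) * (\<Sum>y | adjacent x y. (u y - u x)\<^sup>2)"
  unfolding grad_norm_def by (rule real_sqrt_pow2) (auto intro!: sum_nonneg)

lemma grad_norm_has_sum: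
  assumes "square_summable u"
  shows "((\<lambda>x. (grad_norm u x)\<^sup>2) has_sum dirichlet u) UNIV"
  using has_sum_cmult_right[OF dirichlet_has_sum[OF assms], of "1 / 2"]
  by (simp add: grad_norm_power2)

text \<open>Shifts preserve the mass, so each difference has mass at most \<open>4 * mass u\<close>.
  This boundedness of the discrete gradient is why \<open>H1\<close> is just the space of
  square-summable functions.\<close>

lemma dirichlet_le:
  fixes u :: "'n::finite lattice \<Rightarrow> real"
  assumes "square_summable u"
  shows "dirichlet u \<le> 2 * real (card (unit_steps :: 'n lattice set)) * mass u"
proof -
  have "(\<Sum>e\<in>unit_steps. mass (\<lambda>x. u (x + e) - u x)) \<le> (\<Sum>e\<in>(unit_steps::'n lattice set). 4 * mass u)"
    using square_summable_diff(2)[OF square_summable_shift[OF assms] assms]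
    by (intro sum_mono) (simp add: mass_shift)
  then show ?thesis by (simp add: dirichlet_def)
qed

lemma dirichlet_cmult: "dirichlet (\<lambda>x. c * u x) = c\<^sup>2 * dirichlet u"
  by (simp add: dirichlet_def mass_cmult sum_distrib_left mult.left_commute flip: right_diff_distrib)

lemma dirichlet_young:
  assumes "square_summable u" "square_summable v" "e > 0"
  shows "dirichlet v \<le> (1 + e) * dirichlet u + (1 + 1 / e) * dirichlet (\<lambda>x. u x - v x)"
proof -
  have *: "mass (\<lambda>x. v (x + d) - v x) \<le> (1 + e) * mass (\<lambda>x. u (x + d) - u x)
      + (1 + 1 / e) * mass (\<lambda>x. u (x + d) - v (x + d) - (u x - v x))" for d
    using mass_young[OF square_summable_step[OF assms(1), of d]
        square_summable_step[OF assms(2), of d] assms(3)]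
    by (simp add: algebra_simps)
  have "(\<Sum>d\<in>unit_steps. mass (\<lambda>x. v (x + d) - v x)) \<le>
      (\<Sum>d\<in>unit_steps. (1 + e) * mass (\<lambda>x. u (x + d) - u x)
        + (1 + 1 / e) * mass (\<lambda>x. u (x + d) - v (x + d) - (u x - v x)))"
    by (intro sum_mono *)
  also have "\<dots> = (1 + e) * (\<Sum>d\<in>unit_steps. mass (\<lambda>x. u (x + d) - u x))
      + (1 + 1 / e) * (\<Sum>d\<in>unit_steps. mass (\<lambda>x. u (x + d) - v (x + d) - (u x - v x)))"
    by (simp only: sum.distrib sum_distrib_left)
  finally show ?thesis by (simp add: dirichlet_def)
qed

lemma dirichlet_shift: "dirichlet (\<lambda>x. u (x + z)) = dirichlet u"
proof -
  have "mass (\<lambda>x. u (x + e + z) - u (x + z)) = mass (\<lambda>x. u (x + e) - u x)" for e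
    using mass_shift[of "\<lambda>x. u (x + e) - u x" z] by (simp add: add_ac)
  then show ?thesis by (simp add: dirichlet_def)
qed

lemma dirichlet_abs_le:
  assumes "square_summable u" shows "dirichlet (\<lambda>x. \<bar>u x\<bar>) \<le> dirichlet u"
  unfolding dirichlet_def
  by (intro mult_left_mono sum_mono square_summable_comparison(2) square_summable_step assms) auto

lemma dirichlet_zero: "dirichlet (\<lambda>_. 0) = 0"
  by (simp add: dirichlet_def mass_zero)

section \<open>Identification of \<open>H1\<close> with the square-summable functions\<close>

lemma H1_norm_eq:
  assumes "square_summable u" shows "H1_norm u = sqrt (dirichlet u + mass u)"
  using infsumI[OF dirichlet_has_sum[OF assms]] by (simp add: H1_norm_def mass_def)

text \<open>For a Cauchy sequence, Fatou bounds the mass of \<open>u - \<phi> M\<close> for one late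
  \<open>M\<close>. Conversely, truncations to finite sets exhausting the support are Cauchy,
  because the norm is controlled by the mass and tails have small mass.\<close>

lemma H1_eq_square_summable: "(H1 :: ('n::finite lattice \<Rightarrow> real) set) = {u. square_summable u}"
proof (intro equalityI subsetI CollectI)
  fix u :: "'n lattice \<Rightarrow> real" assume "u \<in> H1"
  then obtain \<phi> where fin: "\<And>n. finitely_supported (\<phi> n)"
    and cauchy: "\<And>e. e > 0 \<Longrightarrow> \<exists>M. \<forall>j\<ge>M. \<forall>k\<ge>M. H1_norm (\<lambda>x. \<phi> j x - \<phi> k x) < e"
    and lim: "\<And>x. (\<lambda>n. \<phi> n x) \<longlonglongrightarrow> u x"
    by (auto simp: H1_def)
  obtain M where M: "\<And>j. j \<ge> M \<Longrightarrow> H1_norm (\<lambda>x. \<phi> j x - \<phi> M x) < 1"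
    using cauchy[of 1] by auto
  have ss: "square_summable (\<phi> n)" for n
    by (rule square_summable_finitely_supported[OF fin])
  let ?g = "\<lambda>n x. (\<phi> (n + M) x - \<phi> M x)\<^sup>2"
  have "(\<lambda>x. (u x - \<phi> M x)\<^sup>2) summable_on UNIV"
  proof (rule infsum_fatou(1)[of ?g])
    show "(\<lambda>n. ?g n x) \<longlonglongrightarrow> (u x - \<phi> M x)\<^sup>2" for x
      by (intro tendsto_intros LIMSEQ_ignore_initial_segment lim)
    show "?g n summable_on UNIV" for n
      using square_summable_diff(1)[OF ss ss] by (simp add: square_summable_def)
    show "infsum (?g n) UNIV \<le> 1" for n
    proof -
      have "sqrt (mass (\<lambda>x. \<phi> (n + M) x - \<phi> M x)) \<le> H1_norm (\<lambda>x. \<phi> (n + M) x - \<phi> M x)"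
        using H1_norm_eq[OF square_summable_diff(1)[OF ss ss]] dirichlet_nonneg by simp
      also have "\<dots> < 1" by (rule M) simp
      finally show ?thesis by (simp add: mass_def)
    qed
  qed auto
  then have "square_summable (\<lambda>x. u x - \<phi> M x)"
    by (simp add: square_summable_def)
  then have "square_summable (\<lambda>x. (u x - \<phi> M x) - (- 1 * \<phi> M x))"
    by (rule square_summable_diff(1)) (intro square_summable_cmult ss)
  then show "square_summable u" by simp
next
  fix u :: "'n lattice \<Rightarrow> real" assume "u \<in> {u. square_summable u}"
  then have u: "square_summable u" by simp
  \<comment> \<open>The constant of \<open>dirichlet_le\<close> plus one: the squared
    \<open>H1_norm\<close> is at most \<open>?K\<close> times the mass.\<close>
  let ?K = "2 * real (card (unit_steps :: 'n lattice set)) + 1"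
  have cnt: "countable {x. u x \<noteq> 0}"
    using summable_countable_real[OF u[unfolded square_summable_def]] by simp
  obtain c :: "nat \<Rightarrow> 'n lattice" where c: "{x. u x \<noteq> 0} \<subseteq> range c"
    using subset_range_from_nat_into[OF cnt] by blast
  define S where "S n = c ` {..n}" for n
  have finS: "finite (S n)" for n by (simp add: S_def)
  have monoS: "S j \<subseteq> S k" if "j \<le> k" for j k using that by (auto simp: S_def)
  have lim: "\<exists>n. x \<in> S n" if "u x \<noteq> 0" for x using c that by (force simp: S_def)
  have ex: "\<exists>M. T \<inter> {x. u x \<noteq> 0} \<subseteq> S M" if "finite T" for T
    using that
  proof (induction T)
    case (insert x T)
    then obtain M where M: "T \<inter> {x. u x \<noteq> 0} \<subseteq> S M" by blast
    show ?case
    proof (cases "u x = 0")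
      case False
      then obtain n where "x \<in> S n" using lim by blast
      then have "insert x T \<inter> {x. u x \<noteq> 0} \<subseteq> S (max n M)"
        using M monoS[of n "max n M"] monoS[of M "max n M"] by auto
      then show ?thesis by blast
    qed (use M in auto)
  qed auto
  have "\<exists>M. \<forall>j\<ge>M. \<forall>k\<ge>M. H1_norm (\<lambda>x. truncate (S j) u x - truncate (S k) u x) < e"
    if "e > 0" for e
  proof -
    obtain T where T: "finite T" "mass u - e\<^sup>2 / ?K < (\<Sum>x\<in>T. (u x)\<^sup>2)"
      using mass_approx[OF u, of "e\<^sup>2 / ?K"] \<open>e > 0\<close> by (auto simp: zero_less_divide_iff)
    obtain M where M: "T \<inter> {x. u x \<noteq> 0} \<subseteq> S M" using ex T(1) by blast
    have "H1_norm (\<lambda>x. truncate (S j) u x - truncate (S k) u x) < e"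
      if jk: "j \<ge> M" "k \<ge> M" for j k
    proof -
      let ?w = "\<lambda>x. truncate (S j) u x - truncate (S k) u x"
      \<comment> \<open>Both truncations agree with \<open>u\<close> on \<open>T\<close>, so they
        differ only off \<open>T\<close>, and there by at most the absolute value of
        \<open>u\<close>.\<close>
      have le: "\<bar>?w x\<bar> \<le> \<bar>u x - truncate T u x\<bar>" for x
        using M monoS[OF jk(1)] monoS[OF jk(2)] by (auto simp: truncate_def)
      have w: "square_summable ?w" "mass ?w \<le> mass (\<lambda>x. u x - truncate T u x)"
        using square_summable_comparison[OF truncate_mass(2)[OF u T(1)] le] by auto
      then have "mass ?w < e\<^sup>2 / ?K"
        using truncate_mass(4)[OF u T(1)] T(2) by simp
      then have "?K * mass ?w < e\<^sup>2" by (simp add: pos_less_divide_eq mult.commute)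
      then have "dirichlet ?w + mass ?w < e\<^sup>2"
        using dirichlet_le[OF w(1)] by (simp add: algebra_simps)
      then show ?thesis
        using H1_norm_eq[OF w(1)] \<open>e > 0\<close> real_sqrt_less_mono by fastforce
    qed
    then show ?thesis by blast
  qed
  moreover have "finitely_supported (truncate (S n) u)" for n
    unfolding finitely_supported_def by (rule finite_subset[OF _ finS[of n]]) (auto simp: truncate_def)
  moreover have "(\<lambda>n. truncate (S n) u x) \<longlonglongrightarrow> u x" for x
  proof (cases "u x = 0")
    case True
    then have "truncate (S n) u x = 0" for n by (simp add: truncate_def)
    with True show ?thesis by simp
  next
    case False
    then obtain n where "x \<in> S n" using lim by blast
    then have "truncate (S k) u x = u x" if "k \<ge> n" for k
      using monoS[OF that] by (auto simp: truncate_def)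
    then show ?thesis
      by (intro tendsto_eventually) (auto simp: eventually_sequentially)
  qed
  ultimately show "u \<in> H1"
    unfolding H1_def by (intro CollectI exI[of _ "\<lambda>n. truncate (S n) u"]) auto
qed

lemma lp_norm_2_power2: "(lp_norm 2 u)\<^sup>2 = mass u"
proof -
  have "(lp_norm 2 u)\<^sup>2 = mass u powr (1 / 2) * mass u powr (1 / 2)"
    by (simp add: lp_norm_def mass_def power2_eq_square powr_numeral)
  also have "\<dots> = mass u"
    using mass_nonneg[of u] by (simp flip: powr_add)
  finally show ?thesis .
qed

lemma lp_2_iff: "u \<in> lp 2 \<longleftrightarrow> square_summable u"
  by (simp add: lp_def square_summable_def)

lemma mass_sphere_eq: "mass_sphere m = {u. square_summable u \<and> mass u = m}"
  by (simp add: mass_sphere_def H1_eq_square_summable lp_norm_2_power2)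


section \<open>The minimal energy\<close>

text \<open>Supports at graph distance at least 2: besides being disjoint, they are joined by no
  edge, which removes the cross terms of the Dirichlet form.\<close>

definition separated :: "('n::finite lattice \<Rightarrow> real) \<Rightarrow> ('n lattice \<Rightarrow> real) \<Rightarrow> bool" where
  "separated u v \<longleftrightarrow> (\<forall>x y. x = y \<or> adjacent x y \<or> adjacent y x \<longrightarrow> u x = 0 \<or> v y = 0)"

lemma separated_same: "separated u v \<Longrightarrow> u x = 0 \<or> v x = 0"
  by (auto simp: separated_def)

lemma mass_add_disjoint:
  assumes "square_summable u" "square_summable v" "\<And>x. u x * v x = 0"
  shows "square_summable (\<lambda>x. u x + v x)" "mass (\<lambda>x. u x + v x) = mass u + mass v"
proof -
  have *: "(u x + v x)\<^sup>2 = (u x)\<^sup>2 + (v x)\<^sup>2" for x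
    using assms(3)[of x] by (simp add: power2_sum)
  show "square_summable (\<lambda>x. u x + v x)" "mass (\<lambda>x. u x + v x) = mass u + mass v"
    unfolding square_summable_def mass_def *
    using assms(1,2) by (auto simp: square_summable_def infsum_add intro: summable_on_add)
qed

text \<open>No edge meets both supports, so along each direction one of the two increments vanishes
  at every point and the squares add.\<close>

lemma dirichlet_add_separated:
  assumes "square_summable u" "square_summable v" "separated u v"
  shows "dirichlet (\<lambda>x. u x + v x) = dirichlet u + dirichlet v"
proof -
  have "mass (\<lambda>x. u (x + e) + v (x + e) - (u x + v x)) =
      mass (\<lambda>x. u (x + e) - u x) + mass (\<lambda>x. v (x + e) - v x)" if e: "e \<in> unit_steps" for e
  proof -
    have "adjacent x (x + e)" for x
      using e by (simp add: adjacent_iff_unit_steps)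
    then have "(u (x + e) - u x) * (v (x + e) - v x) = 0" for x
      using assms(3) unfolding separated_def by (smt (verit) mult_eq_0_iff)
    from mass_add_disjoint(2)[OF square_summable_step[OF assms(1)] square_summable_step[OF assms(2)] this]
    show ?thesis by (simp add: algebra_simps)
  qed
  then show ?thesis
    by (simp add: dirichlet_def sum.distrib flip: distrib_left)
qed

lemma exists_separating_shift:
  fixes u v :: "'n::finite lattice \<Rightarrow> real"
  assumes "finitely_supported u" "finitely_supported v"
  obtains z where "separated u (\<lambda>x. v (x + z))"
proof -
  fix i :: 'n
  have "finite ((\<lambda>x. \<bar>x $ i\<bar>) ` ({x. u x \<noteq> 0} \<union> {x. v x \<noteq> 0}))"
    using assms by (simp add: finitely_supported_def)
  then have "bdd_above ((\<lambda>x. \<bar>x $ i\<bar>) ` ({x. u x \<noteq> 0} \<union> {x. v x \<noteq> 0}))"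
    by (rule bdd_above_finite)
  then obtain K where K: "\<And>x. u x \<noteq> 0 \<or> v x \<noteq> 0 \<Longrightarrow> \<bar>x $ i\<bar> \<le> K"
    unfolding bdd_above_def by blast
  \<comment> \<open>If \<open>y + z\<close> lies in the support of \<open>v\<close>, then
    \<open>y $ i\<close> is at most \<open>- K - 2\<close>, while \<open>x $ i\<close> is at least
    \<open>- K\<close> on the support of \<open>u\<close>; the gap of 2 excludes neighbours as
    well.\<close>
  define z :: "'n lattice" where "z = (\<chi> j. 2 * K + 2)"
  have near: "\<bar>x $ i - y $ i\<bar> \<le> 1" if "adjacent x y" for x y :: "'n lattice"
    using that member_le_sum[of i UNIV "\<lambda>i. \<bar>x $ i - y $ i\<bar>"] by (auto simp: adjacent_def)
  have "u x = 0 \<or> v (y + z) = 0" if "x = y \<or> adjacent x y \<or> adjacent y x" for x y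
  proof (rule ccontr)
    assume "\<not> ?thesis"
    then have "\<bar>x $ i\<bar> \<le> K" "\<bar>(y + z) $ i\<bar> \<le> K" by (blast intro: K)+
    moreover have "\<bar>x $ i - y $ i\<bar> \<le> 1" using that near[of x y] near[of y x] by (auto simp: abs_minus_commute)
    ultimately show False by (simp add: z_def)
  qed
  then show thesis by (intro that[of z]) (simp add: separated_def)
qed

text \<open>The parameter \<open>dim\<close> only fixes the dimension of the lattice.\<close>

locale subquadratic =
  fixes F :: "real \<Rightarrow> real" and dim :: "'n::finite itself"
  assumes small: "e > 0 \<Longrightarrow> \<exists>d>0. \<forall>t. \<bar>t\<bar> \<le> d \<longrightarrow> \<bar>F t\<bar> \<le> e * t\<^sup>2"
    and local_bound: "\<exists>C\<ge>0. \<forall>s t. \<bar>s\<bar> \<le> M \<longrightarrow> \<bar>t\<bar> \<le> M \<longrightarrow>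
      \<bar>F s - F t\<bar> \<le> C * max \<bar>s\<bar> \<bar>t\<bar> * \<bar>s - t\<bar>"
begin

lemma F_0: "F 0 = 0"
proof -
  obtain d where "d > 0" "\<And>t. \<bar>t\<bar> \<le> d \<Longrightarrow> \<bar>F t\<bar> \<le> 1 * t\<^sup>2"
    using small[of 1] by auto
  from this(2)[of 0] this(1) show ?thesis by simp
qed

lemma quadratic_bound: "\<exists>C\<ge>0. \<forall>t. \<bar>t\<bar> \<le> M \<longrightarrow> \<bar>F t\<bar> \<le> C * t\<^sup>2"
proof -
  obtain C where "C \<ge> 0" and C: "\<And>s t. \<bar>s\<bar> \<le> M \<Longrightarrow> \<bar>t\<bar> \<le> M \<Longrightarrow>
      \<bar>F s - F t\<bar> \<le> C * max \<bar>s\<bar> \<bar>t\<bar> * \<bar>s - t\<bar>"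
    using local_bound by metis
  have "\<bar>F t\<bar> \<le> C * t\<^sup>2" if "\<bar>t\<bar> \<le> M" for t
    using C[of t 0] that by (simp add: F_0 power2_eq_square mult.assoc)
  then show ?thesis using \<open>C \<ge> 0\<close> by blast
qed

lemma summable_F:
  assumes "square_summable u" shows "(\<lambda>x. F (u x)) summable_on UNIV"
proof -
  obtain C where "\<And>t. \<bar>t\<bar> \<le> sqrt (mass u) \<Longrightarrow> \<bar>F t\<bar> \<le> C * t\<^sup>2"
    using quadratic_bound by metis
  with abs_le_sqrt_mass[OF assms] have "\<bar>F (u x)\<bar> \<le> C * (u x)\<^sup>2" for x by blast
  moreover have "(\<lambda>x. C * (u x)\<^sup>2) summable_on UNIV"
    using assms by (auto simp: square_summable_def intro: summable_on_cmult_right)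
  ultimately show ?thesis by (rule summable_on_real_comparison[rotated])
qed

definition J :: "('n lattice \<Rightarrow> real) \<Rightarrow> real" where
  "J u = (1 / 2) * dirichlet u - (\<Sum>\<^sub>\<infinity>x. F (u x))"

definition sphere :: "real \<Rightarrow> ('n lattice \<Rightarrow> real) set" where
  "sphere m = {u. square_summable u \<and> mass u = m}"

text \<open>A real infimum, hence meaningful only where the sphere is non-empty and \<open>J\<close>
  is bounded below on it; both hold for \<open>m \<ge> 0\<close>.\<close>

definition E :: "real \<Rightarrow> real" where
  "E m = Inf (J ` sphere m)"

lemma sphere_nonempty:
  assumes "m \<ge> 0" shows "sphere m \<noteq> {}"
proof -
  let ?u = "\<lambda>x :: 'n lattice. if x = 0 then sqrt m else 0"
  have "square_summable ?u"
    by (rule square_summable_finitely_supported) (simp add: finitely_supported_def)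
  moreover have "mass ?u = m"
    using mass_finitely_supported[of "{0}" ?u] assms by simp
  ultimately show ?thesis by (auto simp: sphere_def)
qed

lemma potential_bound: "\<exists>C\<ge>0. \<forall>u :: 'n lattice \<Rightarrow> real. square_summable u \<longrightarrow> mass u \<le> M \<longrightarrow>
    \<bar>\<Sum>\<^sub>\<infinity>x. F (u x)\<bar> \<le> C * mass u"
proof -
  obtain C where "C \<ge> 0" and C: "\<And>t. \<bar>t\<bar> \<le> sqrt M \<Longrightarrow> \<bar>F t\<bar> \<le> C * t\<^sup>2"
    using quadratic_bound by metis
  have "\<bar>\<Sum>\<^sub>\<infinity>x. F (u x)\<bar> \<le> C * mass u" if u: "square_summable u" "mass u \<le> M" for u :: "'n lattice \<Rightarrow> real"
  proof -
    have "\<bar>u x\<bar> \<le> sqrt M" for x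
      using abs_le_sqrt_mass[OF u(1), of x] u(2) real_sqrt_le_mono order_trans by blast
    then have "\<bar>(\<Sum>\<^sub>\<infinity>x. F (u x)) - (\<Sum>\<^sub>\<infinity>x::'n lattice. 0)\<bar> \<le> (\<Sum>\<^sub>\<infinity>x. C * (u x)\<^sup>2)"
      using u(1) C by (intro abs_infsum_diff_le summable_F)
        (auto simp: square_summable_def intro: summable_on_cmult_right)
    then show ?thesis by (simp add: mass_def infsum_cmult_right')
  qed
  then show ?thesis using \<open>C \<ge> 0\<close> by blast
qed

text \<open>The Dirichlet term is non-negative, and the potential is at most a multiple of
  \<open>m\<close>, because \<open>F\<close> is at most quadratic on the values that occur.\<close>

lemma bdd_below_J: "bdd_below (J ` sphere m)"
proof -
  obtain C where C: "\<And>u :: 'n lattice \<Rightarrow> real. square_summable u \<Longrightarrow> mass u \<le> m \<Longrightarrow>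
      \<bar>\<Sum>\<^sub>\<infinity>x. F (u x)\<bar> \<le> C * mass u"
    using potential_bound[of m] by blast
  have "J u \<ge> - C * m" if "u \<in> sphere m" for u
    using C[of u] that dirichlet_nonneg[of u] by (auto simp: sphere_def J_def)
  then show ?thesis by (rule bdd_belowI2)
qed

lemma E_le:
  assumes "square_summable u" shows "E (mass u) \<le> J u"
proof -
  have "u \<in> sphere (mass u)" using assms by (simp add: sphere_def)
  then show ?thesis
    unfolding E_def by (intro cInf_lower imageI bdd_below_J)
qed

lemma E_approx:
  assumes "m \<ge> 0" "e > 0"
  obtains u where "square_summable u" "mass u = m" "J u < E m + e"
proof -
  have "J ` sphere m \<noteq> {}" using sphere_nonempty[OF assms(1)] by simp
  moreover have "Inf (J ` sphere m) < E m + e" using assms(2) by (simp add: E_def)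
  ultimately have "\<exists>y\<in>J ` sphere m. y < E m + e"
    by (rule cInf_lessD)
  then obtain u where "u \<in> sphere m" "J u < E m + e" by blast
  then show thesis using that[of u] by (simp add: sphere_def)
qed

section \<open>Scaling and continuity of the minimal energy\<close>

text \<open>The Dirichlet term is homogeneous of degree 2 and bounded by the mass;
  \<open>local_bound\<close> gives a change of the same order for the potential. \<open>K\<close>
  depends on \<open>M\<close> alone, so the estimate applies to arbitrary near-minimizers.\<close>

lemma J_scale:
  "\<exists>K\<ge>0. \<forall>u t. square_summable u \<longrightarrow> t \<ge> 0 \<longrightarrow> mass u \<le> M \<longrightarrow> t\<^sup>2 * mass u \<le> M \<longrightarrow>
    \<bar>J (\<lambda>x. t * u x) - J u\<bar> \<le> K * \<bar>t\<^sup>2 * mass u - mass u\<bar>"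
proof -
  obtain C where "C \<ge> 0" and C: "\<And>s t. \<bar>s\<bar> \<le> sqrt M \<Longrightarrow> \<bar>t\<bar> \<le> sqrt M \<Longrightarrow>
      \<bar>F s - F t\<bar> \<le> C * max \<bar>s\<bar> \<bar>t\<bar> * \<bar>s - t\<bar>"
    using local_bound by metis
  define d where "d = real (card (unit_steps :: 'n lattice set))"
  have "\<bar>J (\<lambda>x. t * u x) - J u\<bar> \<le> (d + C) * \<bar>t\<^sup>2 * mass u - mass u\<bar>"
    if u: "square_summable u" and t: "t \<ge> 0" and M: "mass u \<le> M" "t\<^sup>2 * mass u \<le> M" for u t
  proof -
    have tu: "square_summable (\<lambda>x. t * u x)" by (rule square_summable_cmult[OF u])
    have "\<bar>F (t * u x) - F (u x)\<bar> \<le> C * \<bar>t\<^sup>2 - 1\<bar> * (u x)\<^sup>2" for x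
    proof -
      have "\<bar>u x\<bar> \<le> sqrt M" "\<bar>t * u x\<bar> \<le> sqrt M"
        using abs_le_sqrt_mass[OF u, of x] abs_le_sqrt_mass[OF tu, of x] M
        by (auto simp: mass_cmult intro: order_trans[OF _ real_sqrt_le_mono])
      then have "\<bar>F (t * u x) - F (u x)\<bar> \<le> C * max \<bar>t * u x\<bar> \<bar>u x\<bar> * \<bar>t * u x - u x\<bar>"
        by (rule C[rotated])
      \<comment> \<open>\<open>t + 1\<close> is the factor that turns \<open>t - 1\<close> into
        \<open>t\<^sup>2 - 1\<close>, the relative change of mass.\<close>
      also have "max \<bar>t * u x\<bar> \<bar>u x\<bar> \<le> (t + 1) * \<bar>u x\<bar>"
        using t by (auto simp: abs_mult algebra_simps)
      also have "C * ((t + 1) * \<bar>u x\<bar>) * \<bar>t * u x - u x\<bar> = C * \<bar>(t + 1) * (t - 1)\<bar> * \<bar>u x * u x\<bar>"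
      proof -
        have "\<bar>t * u x - u x\<bar> = \<bar>t - 1\<bar> * \<bar>u x\<bar>" by (simp add: algebra_simps flip: abs_mult)
        then show ?thesis using t by (simp add: abs_mult)
      qed
      also have "(t + 1) * (t - 1) = t\<^sup>2 - 1" by (simp add: algebra_simps power2_eq_square)
      finally show ?thesis
        using \<open>C \<ge> 0\<close> by (simp add: power2_eq_square mult_left_mono mult_right_mono)
    qed
    then have "\<bar>(\<Sum>\<^sub>\<infinity>x. F (t * u x)) - (\<Sum>\<^sub>\<infinity>x. F (u x))\<bar> \<le> (\<Sum>\<^sub>\<infinity>x. C * \<bar>t\<^sup>2 - 1\<bar> * (u x)\<^sup>2)"
      using u by (intro abs_infsum_diff_le summable_F tu)
        (auto simp: square_summable_def intro: summable_on_cmult_right)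
    also have "\<dots> = C * \<bar>t\<^sup>2 - 1\<bar> * mass u" by (simp add: mass_def infsum_cmult_right')
    finally have 1: "\<bar>(\<Sum>\<^sub>\<infinity>x. F (t * u x)) - (\<Sum>\<^sub>\<infinity>x. F (u x))\<bar> \<le> C * \<bar>t\<^sup>2 - 1\<bar> * mass u" .
    have "(1/2) * dirichlet (\<lambda>x. t * u x) - (1/2) * dirichlet u = (t\<^sup>2 - 1) * ((1/2) * dirichlet u)"
      by (simp add: dirichlet_cmult algebra_simps)
    then have "\<bar>(1/2) * dirichlet (\<lambda>x. t * u x) - (1/2) * dirichlet u\<bar> = \<bar>t\<^sup>2 - 1\<bar> * ((1/2) * dirichlet u)"
      using dirichlet_nonneg[of u] by (simp only: abs_mult)
    also have "\<dots> \<le> \<bar>t\<^sup>2 - 1\<bar> * (d * mass u)"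
      using dirichlet_le[OF u] by (intro mult_left_mono) (auto simp: d_def)
    finally have "\<bar>J (\<lambda>x. t * u x) - J u\<bar> \<le> \<bar>t\<^sup>2 - 1\<bar> * (d * mass u) + C * \<bar>t\<^sup>2 - 1\<bar> * mass u"
      using 1 unfolding J_def by linarith
    also have "\<dots> = (d + C) * (\<bar>t\<^sup>2 - 1\<bar> * \<bar>mass u\<bar>)"
      using mass_nonneg[of u] by (simp add: algebra_simps)
    also have "\<bar>t\<^sup>2 - 1\<bar> * \<bar>mass u\<bar> = \<bar>t\<^sup>2 * mass u - mass u\<bar>"
      by (simp add: algebra_simps flip: abs_mult)
    finally show ?thesis .
  qed
  moreover have "d + C \<ge> 0" using \<open>C \<ge> 0\<close> by (simp add: d_def)
  ultimately show ?thesis by blast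
qed

lemma rescale_to_mass:
  "\<exists>K\<ge>0. \<forall>u m. square_summable u \<longrightarrow> 0 < mass u \<longrightarrow> mass u \<le> M \<longrightarrow> 0 \<le> m \<longrightarrow> m \<le> M \<longrightarrow>
    (\<exists>t\<ge>0. mass (\<lambda>x. t * u x) = m \<and> \<bar>J (\<lambda>x. t * u x) - J u\<bar> \<le> K * \<bar>m - mass u\<bar>)"
proof -
  obtain K where "K \<ge> 0" and K: "\<And>u t. square_summable u \<Longrightarrow> t \<ge> 0 \<Longrightarrow> mass u \<le> M \<Longrightarrow>
      t\<^sup>2 * mass u \<le> M \<Longrightarrow> \<bar>J (\<lambda>x. t * u x) - J u\<bar> \<le> K * \<bar>t\<^sup>2 * mass u - mass u\<bar>"
    using J_scale[of M] by blast
  have "\<exists>t\<ge>0. mass (\<lambda>x. t * u x) = m \<and> \<bar>J (\<lambda>x. t * u x) - J u\<bar> \<le> K * \<bar>m - mass u\<bar>"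
    if "square_summable u" "0 < mass u" "mass u \<le> M" "0 \<le> m" "m \<le> M" for u m
  proof -
    have "(sqrt (m / mass u))\<^sup>2 * mass u = m" using that by simp
    then show ?thesis
      using K[of u "sqrt (m / mass u)"] that by (intro exI[of _ "sqrt (m / mass u)"]) (simp add: mass_cmult)
  qed
  then show ?thesis using \<open>K \<ge> 0\<close> by blast
qed

lemma E_lipschitz:
  "\<exists>K\<ge>0. \<forall>m n. 0 < m \<longrightarrow> m \<le> M \<longrightarrow> 0 < n \<longrightarrow> n \<le> M \<longrightarrow> \<bar>E m - E n\<bar> \<le> K * \<bar>m - n\<bar>"
proof -
  obtain K where "K \<ge> 0" and K: "\<And>u m. square_summable u \<Longrightarrow> 0 < mass u \<Longrightarrow> mass u \<le> M \<Longrightarrow> 0 \<le> m \<Longrightarrow>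
      m \<le> M \<Longrightarrow> \<exists>t\<ge>0. mass (\<lambda>x. t * u x) = m \<and> \<bar>J (\<lambda>x. t * u x) - J u\<bar> \<le> K * \<bar>m - mass u\<bar>"
    using rescale_to_mass[of M] by blast
  have le: "E m \<le> E n + K * \<bar>m - n\<bar>" if mn: "0 < m" "m \<le> M" "0 < n" "n \<le> M" for m n
  proof (rule field_le_epsilon)
    fix e :: real assume "e > 0"
    then obtain u where u: "square_summable u" "mass u = n" "J u < E n + e"
      using E_approx[of n e] mn by auto
    then obtain t where "mass (\<lambda>x. t * u x) = m" "\<bar>J (\<lambda>x. t * u x) - J u\<bar> \<le> K * \<bar>m - n\<bar>"
      using K[of u m] mn by auto
    then show "E m \<le> E n + K * \<bar>m - n\<bar> + e"
      using E_le[OF square_summable_cmult[OF u(1)], of t] u(3) by auto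
  qed
  have "\<bar>E m - E n\<bar> \<le> K * \<bar>m - n\<bar>" if mn: "0 < m" "m \<le> M" "0 < n" "n \<le> M" for m n
    using le[of m n] le[of n m] mn by (simp add: abs_le_iff abs_minus_commute)
  then show ?thesis using \<open>K \<ge> 0\<close> by blast
qed

lemma continuous_on_E: "continuous_on {0<..} E"
proof (rule continuous_at_imp_continuous_on, rule ballI)
  fix m :: real assume "m \<in> {0<..}"
  then have m: "m > 0" by simp
  obtain K where "K \<ge> 0" and K: "\<And>p n. 0 < p \<Longrightarrow> p \<le> 2 * m \<Longrightarrow> 0 < n \<Longrightarrow> n \<le> 2 * m \<Longrightarrow>
      \<bar>E p - E n\<bar> \<le> K * \<bar>p - n\<bar>"
    using E_lipschitz[of "2 * m"] by blast
  have "K-lipschitz_on {0<..<2 * m} E"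
  proof (rule lipschitz_onI)
    fix p n assume "p \<in> {0<..<2 * m}" "n \<in> {0<..<2 * m}"
    then show "dist (E p) (E n) \<le> K * dist p n"
      using K[of p n] by (simp add: dist_real_def)
  qed (rule \<open>K \<ge> 0\<close>)
  then have "continuous_on {0<..<2 * m} E" by (rule lipschitz_on_continuous_on)
  then show "isCont E m"
    by (rule continuous_on_interior) (use m in auto)
qed

section \<open>Finite supports and subadditivity\<close>

text \<open>A truncation loses a little mass \<open>\<tau>\<close>, and scaling restores it exactly.
  All errors are of order \<open>\<tau>\<close>, except for a share of the Dirichlet energy that the
  parameter in Young's inequality makes small.\<close>

lemma approx_finitely_supported:
  assumes u: "square_summable u" "mass u > 0" and e: "e > 0"
  obtains v where "finitely_supported v" "mass v = mass u" "J v < J u + e"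
proof -
  let ?m = "mass u"
  obtain K where "K \<ge> 0" and K: "\<And>u m. square_summable u \<Longrightarrow> 0 < mass u \<Longrightarrow> mass u \<le> ?m \<Longrightarrow> 0 \<le> m \<Longrightarrow>
      m \<le> ?m \<Longrightarrow> \<exists>t\<ge>0. mass (\<lambda>x. t * u x) = m \<and> \<bar>J (\<lambda>x. t * u x) - J u\<bar> \<le> K * \<bar>m - mass u\<bar>"
    using rescale_to_mass[of ?m] by blast
  obtain C where "C \<ge> 0" and C: "\<And>t. \<bar>t\<bar> \<le> sqrt ?m \<Longrightarrow> \<bar>F t\<bar> \<le> C * t\<^sup>2"
    using quadratic_bound by metis
  define d where "d = real (card (unit_steps :: 'n lattice set))"
  \<comment> \<open>The Young parameter: the excess \<open>r * dirichlet u\<close> costs at most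
    \<open>e / 2\<close> in \<open>J\<close>.\<close>
  define r where "r = e / (dirichlet u + 1)"
  have r: "r > 0" "r * dirichlet u \<le> e"
    using e dirichlet_nonneg[of u] by (auto simp: r_def field_simps intro: add_nonneg_pos)
  \<comment> \<open>The coefficients of \<open>\<tau>\<close> from the Dirichlet energy of the tail,
    the potential of the tail and the rescaling; the 1 makes \<open>L\<close> positive.\<close>
  define L where "L = (1 + 1 / r) * d + C + K + 1"
  have L: "L > 0" using r \<open>C \<ge> 0\<close> \<open>K \<ge> 0\<close> by (auto simp: L_def d_def intro!: add_nonneg_pos add_nonneg_nonneg)
  \<comment> \<open>The minimum with \<open>?m\<close> leaves the truncation a positive mass,
    without which it could not be rescaled.\<close>
  obtain S where S: "finite S" "?m - min ?m (e / 2 / L) < (\<Sum>x\<in>S. (u x)\<^sup>2)" "(\<Sum>x\<in>S. (u x)\<^sup>2) \<le> ?m"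
    using mass_approx[OF u(1), of "min ?m (e / 2 / L)"] u(2) e L by auto
  define \<tau> where "\<tau> = ?m - (\<Sum>x\<in>S. (u x)\<^sup>2)"
  let ?v = "truncate S u"
  note tr = truncate_mass[OF u(1) S(1)]
  have \<tau>: "0 \<le> \<tau>" "\<tau> < ?m" "\<tau> < e / 2 / L"
    using S by (auto simp: \<tau>_def)
  then have L\<tau>: "L * \<tau> < e / 2"
    using L by (simp add: pos_less_divide_eq mult_ac)
  have mv: "mass ?v = ?m - \<tau>" "mass (\<lambda>x. u x - ?v x) = \<tau>" using tr by (auto simp: \<tau>_def)
  obtain t where t: "mass (\<lambda>x. t * ?v x) = ?m" "\<bar>J (\<lambda>x. t * ?v x) - J ?v\<bar> \<le> K * \<tau>"
    using K[of ?v ?m] tr(1) mv \<tau> by auto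
  have "dirichlet ?v \<le> (1 + r) * dirichlet u + (1 + 1 / r) * dirichlet (\<lambda>x. u x - ?v x)"
    by (rule dirichlet_young[OF u(1) tr(1) r(1)])
  moreover have "dirichlet (\<lambda>x. u x - ?v x) \<le> 2 * d * \<tau>"
    using dirichlet_le[OF tr(2)] mv by (simp add: d_def)
  then have "(1 + 1 / r) * dirichlet (\<lambda>x. u x - ?v x) \<le> (1 + 1 / r) * (2 * d * \<tau>)"
    using r by (intro mult_left_mono) auto
  ultimately have D: "dirichlet ?v \<le> dirichlet u + e + 2 * ((1 + 1 / r) * d * \<tau>)"
    using r(2) by (simp add: algebra_simps)
  have "\<bar>F (u x) - F (?v x)\<bar> \<le> C * (u x - ?v x)\<^sup>2" for x
    using C[OF abs_le_sqrt_mass[OF u(1), of x]] by (auto simp: truncate_def F_0)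
  then have "\<bar>(\<Sum>\<^sub>\<infinity>x. F (u x)) - (\<Sum>\<^sub>\<infinity>x. F (?v x))\<bar> \<le> (\<Sum>\<^sub>\<infinity>x. C * (u x - ?v x)\<^sup>2)"
    using tr(2) by (intro abs_infsum_diff_le summable_F tr(1) u(1))
      (auto simp: square_summable_def intro: summable_on_cmult_right)
  also have "\<dots> = C * \<tau>" using mv by (simp add: mass_def infsum_cmult_right')
  finally have "J ?v \<le> J u + e / 2 + (1 + 1 / r) * d * \<tau> + C * \<tau>"
    using D unfolding J_def by linarith
  then have "J (\<lambda>x. t * ?v x) \<le> J u + e / 2 + (L * \<tau> - \<tau>)"
    using t(2) by (simp add: L_def algebra_simps)
  then have "J (\<lambda>x. t * ?v x) < J u + e" using \<tau>(1) L\<tau> by linarith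
  moreover have "finitely_supported (\<lambda>x. t * ?v x)"
    unfolding finitely_supported_def by (rule finite_subset[OF _ S(1)]) (auto simp: truncate_def)
  ultimately show thesis using t(1) by (intro that[of "\<lambda>x. t * ?v x"])
qed

lemma J_shift: "J (\<lambda>x. u (x + z)) = J u"
  using infsum_reindex_bij_betw[OF bij_shift, of "\<lambda>x. F (u x)" z] by (simp add: J_def dirichlet_shift)

lemma J_add_separated:
  assumes "square_summable u" "square_summable v" "separated u v"
  shows "J (\<lambda>x. u x + v x) = J u + J v"
proof -
  have "F (u x + v x) = F (u x) + F (v x)" for x
    using separated_same[OF assms(3), of x] by (auto simp: F_0)
  then have "(\<Sum>\<^sub>\<infinity>x. F (u x + v x)) = (\<Sum>\<^sub>\<infinity>x. F (u x)) + (\<Sum>\<^sub>\<infinity>x. F (v x))"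
    using infsum_add[OF summable_F[OF assms(1)] summable_F[OF assms(2)]] by simp
  then show ?thesis
    unfolding J_def dirichlet_add_separated[OF assms] by simp
qed

lemma E_subadditive:
  assumes "m > 0" "n > 0" shows "E (m + n) \<le> E m + E n"
proof (rule field_le_epsilon)
  fix e :: real assume "e > 0"
  obtain u0 where u0: "square_summable u0" "mass u0 = m" "J u0 < E m + e / 4"
    using E_approx[of m "e / 4"] assms \<open>e > 0\<close> by auto
  obtain v0 where v0: "square_summable v0" "mass v0 = n" "J v0 < E n + e / 4"
    using E_approx[of n "e / 4"] assms \<open>e > 0\<close> by auto
  obtain u where u: "finitely_supported u" "mass u = m" "J u < J u0 + e / 4"
    using approx_finitely_supported[OF u0(1), of "e / 4"] u0 assms \<open>e > 0\<close> by auto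
  obtain v where v: "finitely_supported v" "mass v = n" "J v < J v0 + e / 4"
    using approx_finitely_supported[OF v0(1), of "e / 4"] v0 assms \<open>e > 0\<close> by auto
  obtain z where z: "separated u (\<lambda>x. v (x + z))"
    using exists_separating_shift[OF u(1) v(1)] .
  note ss = square_summable_finitely_supported[OF u(1)]
    square_summable_shift[OF square_summable_finitely_supported[OF v(1)], of z]
  have "u x * v (x + z) = 0" for x using separated_same[OF z, of x] by auto
  from mass_add_disjoint[OF ss this] J_add_separated[OF ss z]
  have "square_summable (\<lambda>x. u x + v (x + z))" "mass (\<lambda>x. u x + v (x + z)) = m + n"
    "J (\<lambda>x. u x + v (x + z)) = J u + J v"
    using u v by (auto simp: mass_shift J_shift)
  then have "E (m + n) \<le> J u + J v" using E_le by metis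
  then show "E (m + n) \<le> E m + E n + e" using u0 v0 u v by linarith
qed

end


section \<open>Minimizers\<close>

text \<open>In each direction \<open>e\<close> only the increments at \<open>a\<close> and
  \<open>a - e\<close> involve the value at \<open>a\<close>; their squares change by
  \<open>2 * s\<^sup>2 - 2 * s * (u (a + e) + u (a - e))\<close>. Of the non-negative neighbour
  values in the linear term, one copy of \<open>u b\<close> is kept.\<close>

lemma dirichlet_update_zero:
  fixes u :: "'n::finite lattice \<Rightarrow> real"
  assumes "square_summable u" "u a = 0" "\<And>x. u x \<ge> 0" "s \<ge> 0" "adjacent a b"
  shows "dirichlet (u(a := s)) \<le> dirichlet u + real (card (unit_steps :: 'n lattice set)) * s\<^sup>2 - s * u b"
proof -
  let ?v = "u(a := s)"
  have step: "mass (\<lambda>x. ?v (x + e) - ?v x) =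
      mass (\<lambda>x. u (x + e) - u x) + 2 * s\<^sup>2 - 2 * s * (u (a + e) + u (a - e))"
    if "e \<in> unit_steps" for e
  proof -
    have "e \<noteq> 0" using that zero_notin_unit_steps by auto
    then have ne: "a - e \<noteq> a" "a + e \<noteq> a" by auto
    have "mass (\<lambda>x. ?v (x + e) - ?v x) = mass (\<lambda>x. u (x + e) - u x) +
        (\<Sum>x\<in>{a, a - e}. (?v (x + e) - ?v x)\<^sup>2 - (u (x + e) - u x)\<^sup>2)"
      unfolding mass_def
    proof (rule infsum_change_finite(2))
      show "(?v (x + e) - ?v x)\<^sup>2 = (u (x + e) - u x)\<^sup>2" if "x \<notin> {a, a - e}" for x
      proof -
        have "x + e \<noteq> a" "x \<noteq> a" using that by (auto simp: algebra_simps)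
        then show ?thesis by simp
      qed
    qed (use square_summable_step[OF assms(1), of e] in \<open>auto simp: square_summable_def\<close>)
    also have "(\<Sum>x\<in>{a, a - e}. (?v (x + e) - ?v x)\<^sup>2 - (u (x + e) - u x)\<^sup>2) =
        2 * s\<^sup>2 - 2 * s * (u (a + e) + u (a - e))"
      using ne assms(2) by (auto simp: power2_eq_square algebra_simps)
    finally show ?thesis by simp
  qed
  have "(\<Sum>e\<in>unit_steps. mass (\<lambda>x. ?v (x + e) - ?v x)) = (\<Sum>e\<in>unit_steps. mass (\<lambda>x. u (x + e) - u x)) +
      2 * real (card (unit_steps :: 'n lattice set)) * s\<^sup>2 - 2 * s * (\<Sum>e\<in>unit_steps. u (a + e) + u (a - e))"
    by (subst sum.cong[OF refl step]) (simp_all add: sum.distrib sum_subtractf flip: sum_distrib_left)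
  moreover have "u (a + (b - a)) \<le> (\<Sum>e\<in>unit_steps. u (a + e) + u (a - e))"
  proof -
    have "u (a + (b - a)) + u (a - (b - a)) \<le> (\<Sum>e\<in>unit_steps. u (a + e) + u (a - e))"
      using assms(5) finite_unit_steps
      by (intro member_le_sum[of _ _ "\<lambda>e. u (a + e) + u (a - e)"])
        (auto simp: adjacent_iff_unit_steps assms(3))
    with assms(3)[of "a - (b - a)"] show ?thesis by linarith
  qed
  then have "s * u b \<le> s * (\<Sum>e\<in>unit_steps. u (a + e) + u (a - e))"
    using assms(4) by (intro mult_left_mono) auto
  ultimately show ?thesis
    unfolding dirichlet_def by (simp add: algebra_simps)
qed

text \<open>Induction on the graph distance to \<open>y\<close>, moving one differing coordinate by
  1 towards its target.\<close>

lemma lattice_connected: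
  fixes x y :: "'n::finite lattice"
  assumes "P x" and step: "\<And>x y :: 'n lattice. P x \<Longrightarrow> adjacent x y \<Longrightarrow> P y"
  shows "P y"
  using assms(1)
proof (induction "nat (\<Sum>i\<in>UNIV. \<bar>x $ i - y $ i\<bar>)" arbitrary: x rule: less_induct)
  case less
  show ?case
  proof (cases "x = y")
    case False
    then obtain i where i: "x $ i \<noteq> y $ i" by (auto simp: vec_eq_iff)
    define z where "z = (\<chi> j. if j = i then x $ i + sgn (y $ i - x $ i) else x $ j)"
    have "(\<Sum>j\<in>UNIV. \<bar>x $ j - z $ j\<bar>) = (\<Sum>j\<in>UNIV. if j = i then 1 else 0)"
      using i by (intro sum.cong) (auto simp: z_def sgn_if)
    then have "adjacent x z" by (simp add: adjacent_def)
    moreover have "(\<Sum>j\<in>UNIV. \<bar>x $ j - y $ j\<bar>) = (\<Sum>j\<in>UNIV. \<bar>z $ j - y $ j\<bar> + (if j = i then 1 else 0))"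
      using i by (intro sum.cong) (auto simp: z_def sgn_if)
    then have "(\<Sum>j\<in>UNIV. \<bar>x $ j - y $ j\<bar>) = (\<Sum>j\<in>UNIV. \<bar>z $ j - y $ j\<bar>) + 1"
      by (simp add: sum.distrib)
    then have "nat (\<Sum>j\<in>UNIV. \<bar>z $ j - y $ j\<bar>) < nat (\<Sum>j\<in>UNIV. \<bar>x $ j - y $ j\<bar>)"
      by (simp add: sum_nonneg nat_less_iff)
    ultimately show ?thesis using less.hyps step less.prems by blast
  qed (use less.prems in simp)
qed

context subquadratic
begin

lemma isCont_F: "isCont F t"
proof -
  obtain C where "C \<ge> 0" and C: "\<And>a b. \<bar>a\<bar> \<le> \<bar>t\<bar> + 1 \<Longrightarrow> \<bar>b\<bar> \<le> \<bar>t\<bar> + 1 \<Longrightarrow>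
      \<bar>F a - F b\<bar> \<le> C * max \<bar>a\<bar> \<bar>b\<bar> * \<bar>a - b\<bar>"
    using local_bound[of "\<bar>t\<bar> + 1"] by blast
  have "(C * (\<bar>t\<bar> + 1))-lipschitz_on {- (\<bar>t\<bar> + 1)<..<\<bar>t\<bar> + 1} F"
  proof (rule lipschitz_onI)
    fix a b assume "a \<in> {- (\<bar>t\<bar> + 1)<..<\<bar>t\<bar> + 1}" "b \<in> {- (\<bar>t\<bar> + 1)<..<\<bar>t\<bar> + 1}"
    then have ab: "\<bar>a\<bar> \<le> \<bar>t\<bar> + 1" "\<bar>b\<bar> \<le> \<bar>t\<bar> + 1" by auto
    then have "\<bar>F a - F b\<bar> \<le> C * max \<bar>a\<bar> \<bar>b\<bar> * \<bar>a - b\<bar>" by (rule C)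
    also have "\<dots> \<le> C * (\<bar>t\<bar> + 1) * \<bar>a - b\<bar>"
      using ab \<open>C \<ge> 0\<close> by (intro mult_right_mono mult_left_mono) auto
    finally show "dist (F a) (F b) \<le> C * (\<bar>t\<bar> + 1) * dist a b" by (simp add: dist_real_def)
  qed (use \<open>C \<ge> 0\<close> in simp)
  then have "continuous_on {- (\<bar>t\<bar> + 1)<..<\<bar>t\<bar> + 1} F" by (rule lipschitz_on_continuous_on)
  then show ?thesis by (rule continuous_on_interior) auto
qed

text \<open>Vanishing of \<open>F t / t\<^sup>2\<close> at 0 makes the contribution of the points outside a finite set
  uniformly small, so the potential energy passes to uniform limits of bounded mass.\<close>

lemma potential_uniform_limit:
  assumes v: "\<And>n. square_summable (v n)" "\<And>n. mass (v n) = m" and w: "square_summable w" "mass w \<le> m"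
    and unif: "\<And>e. e > 0 \<Longrightarrow> \<forall>\<^sub>F n in sequentially. \<forall>x. \<bar>v n x - w x\<bar> \<le> e"
    and lim: "\<And>x. (\<lambda>n. v n x) \<longlonglongrightarrow> w x" and m: "m > 0" and e: "e > 0"
  shows "\<forall>\<^sub>F n in sequentially. (\<Sum>\<^sub>\<infinity>x. F (v n x)) \<le> (\<Sum>\<^sub>\<infinity>x. F (w x)) + e"
proof -
  \<comment> \<open>The error \<open>e\<close> is shared by the tail of \<open>v n\<close>, the tail
    of \<open>w\<close> and the finite part; a tail costs at most \<open>h\<close> times its
    mass.\<close>
  define h where "h = e / (3 * m)"
  have h: "h > 0" "h * m = e / 3" using m e by (auto simp: h_def)
  obtain d where "d > 0" and d: "\<And>t. \<bar>t\<bar> \<le> d \<Longrightarrow> \<bar>F t\<bar> \<le> h * t\<^sup>2"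
    using small[OF h(1)] by blast
  \<comment> \<open>The threshold is half of \<open>d\<close>, so that off \<open>B\<close> also
    every \<open>v n\<close> within \<open>d / 2\<close> of \<open>w\<close> stays below
    \<open>d\<close>.\<close>
  define B where "B = {x. \<bar>w x\<bar> > d / 2}"
  have fin: "finite B"
    unfolding B_def using \<open>d > 0\<close> by (intro finite_superlevel[OF w(1)]) simp
  have split: "\<bar>(\<Sum>\<^sub>\<infinity>x. F (u x)) - (\<Sum>x\<in>B. F (u x))\<bar> \<le> e / 3"
    if u: "square_summable u" "mass u \<le> m" and small: "\<And>x. x \<notin> B \<Longrightarrow> \<bar>u x\<bar> \<le> d" for u
  proof -
    have b: "((\<lambda>x. truncate B (\<lambda>x. F (u x)) x) has_sum (\<Sum>x\<in>B. F (u x))) UNIV"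
      by (rule has_sum_finite_neutralI[OF fin]) (auto simp: truncate_def)
    have "\<bar>(\<Sum>\<^sub>\<infinity>x. F (u x)) - (\<Sum>\<^sub>\<infinity>x. truncate B (\<lambda>x. F (u x)) x)\<bar> \<le> (\<Sum>\<^sub>\<infinity>x. h * (u x)\<^sup>2)"
    proof (rule abs_infsum_diff_le)
      show "(\<lambda>x. h * (u x)\<^sup>2) summable_on UNIV"
        using u(1) by (auto simp: square_summable_def intro: summable_on_cmult_right)
      show "\<bar>F (u x) - truncate B (\<lambda>x. F (u x)) x\<bar> \<le> h * (u x)\<^sup>2" for x
        using d[of "u x"] small[of x] h(1) by (auto simp: truncate_def)
    qed (use b in \<open>auto simp: summable_F[OF u(1)] has_sum_iff\<close>)
    also have "\<dots> = h * mass u" by (simp add: mass_def infsum_cmult_right')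
    also have "\<dots> \<le> h * m" using u(2) h(1) by simp
    finally show ?thesis using b h(2) by (simp add: has_sum_iff)
  qed
  have "(\<lambda>n. \<Sum>x\<in>B. F (v n x)) \<longlonglongrightarrow> (\<Sum>x\<in>B. F (w x))"
    by (intro tendsto_sum isCont_tendsto_compose[OF isCont_F] lim)
  then have ev: "\<forall>\<^sub>F n in sequentially. (\<Sum>x\<in>B. F (v n x)) < (\<Sum>x\<in>B. F (w x)) + e / 3"
    by (rule order_tendstoD) (use e in simp)
  have sw: "\<bar>(\<Sum>\<^sub>\<infinity>x. F (w x)) - (\<Sum>x\<in>B. F (w x))\<bar> \<le> e / 3"
    using \<open>d > 0\<close> by (intro split w) (auto simp: B_def)
  have ev2: "\<forall>\<^sub>F n in sequentially. \<forall>x. \<bar>v n x - w x\<bar> \<le> d / 2"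
    using \<open>d > 0\<close> by (intro unif) simp
  show ?thesis
    using ev ev2
  proof eventually_elim
    case (elim n)
    have "\<bar>v n x\<bar> \<le> d" if "x \<notin> B" for x
    proof -
      have "\<bar>w x\<bar> \<le> d / 2" using that by (simp add: B_def)
      with elim(2)[rule_format, of x] show ?thesis by linarith
    qed
    then have "\<bar>(\<Sum>\<^sub>\<infinity>x. F (v n x)) - (\<Sum>x\<in>B. F (v n x))\<bar> \<le> e / 3"
      by (intro split v(1)) (auto simp: v(2))
    with elim(1) sw show ?case by linarith
  qed
qed

lemma E_strict_decreasing:
  assumes neg: "\<And>m. m > 0 \<Longrightarrow> E m < 0" and "0 < m" "m < n"
  shows "E n < E m"
  using E_subadditive[of m "n - m"] neg[of "n - m"] assms(2,3) by simp

lemma J_zero: "J (\<lambda>_. 0) = 0"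
  by (simp add: J_def dirichlet_zero F_0)

text \<open>Mass may escape in the limit, but the limit still has energy at most \<open>E m\<close>; strict
  monotonicity of \<open>E\<close> then excludes the loss of mass.\<close>

lemma uniform_limit_minimizer:
  assumes neg: "\<And>m. m > 0 \<Longrightarrow> E m < 0" and m: "m > 0"
    and v: "\<And>n. square_summable (v n)" "\<And>n. mass (v n) = m"
    and J: "\<And>n. J (v n) \<le> E m + c n" and c: "c \<longlonglongrightarrow> 0"
    and unif: "\<And>e. e > 0 \<Longrightarrow> \<forall>\<^sub>F n in sequentially. \<forall>x. \<bar>v n x - w x\<bar> \<le> e"
  shows "square_summable w" "mass w = m" "J w = E m"
proof -
  note lim = uniform_limit_pointwise[OF unif]
  have lim2: "(\<lambda>n. (v n x)\<^sup>2) \<longlonglongrightarrow> (w x)\<^sup>2" for x by (intro tendsto_intros lim)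
  have w: "square_summable w" "mass w \<le> m"
    using infsum_fatou[of "\<lambda>n x. (v n x)\<^sup>2" "\<lambda>x. (w x)\<^sup>2" "\<lambda>_. m" m, OF lim2] v
    by (auto simp: square_summable_def mass_def)
  have "J w \<le> E m"
  proof (rule field_le_epsilon)
    fix e :: real assume "e > 0"
    let ?P = "\<Sum>\<^sub>\<infinity>x. F (w x)"
    have "\<forall>\<^sub>F n in sequentially. (\<Sum>\<^sub>\<infinity>x. F (v n x)) \<le> ?P + e"
      by (rule potential_uniform_limit[OF v w unif lim m \<open>e > 0\<close>])
    then obtain N where N: "\<And>n. n \<ge> N \<Longrightarrow> (\<Sum>\<^sub>\<infinity>x. F (v n x)) \<le> ?P + e"
      unfolding eventually_sequentially by blast
    have grad: "((\<lambda>x. (grad_norm (v n) x)\<^sup>2) has_sum dirichlet (v n)) UNIV" for n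
      by (rule grad_norm_has_sum[OF v(1)])
    \<comment> \<open>Half the Dirichlet energy of \<open>v n\<close> is \<open>J (v n)\<close> plus
      its potential, which is under control from index \<open>N\<close> on. The summand 0 is the
      limit of \<open>c\<close>.\<close>
    have "(\<Sum>\<^sub>\<infinity>x. (grad_norm w x)\<^sup>2) \<le> 2 * (E m + 0 + ?P + e)"
    proof (rule infsum_fatou(2)[where g = "\<lambda>n x. (grad_norm (v (n + N)) x)\<^sup>2"
          and c = "\<lambda>n. 2 * (E m + c (n + N) + ?P + e)"])
      show "(\<lambda>n. (grad_norm (v (n + N)) x)\<^sup>2) \<longlonglongrightarrow> (grad_norm w x)\<^sup>2" for x
        unfolding grad_norm_def by (intro tendsto_intros LIMSEQ_ignore_initial_segment lim)
      show "(\<lambda>n. 2 * (E m + c (n + N) + ?P + e)) \<longlonglongrightarrow> 2 * (E m + 0 + ?P + e)"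
        by (intro tendsto_intros LIMSEQ_ignore_initial_segment c)
      show "(\<lambda>x. (grad_norm (v (n + N)) x)\<^sup>2) summable_on UNIV" for n
        using grad by (auto simp: has_sum_iff)
      show "(\<Sum>\<^sub>\<infinity>x. (grad_norm (v (n + N)) x)\<^sup>2) \<le> 2 * (E m + c (n + N) + ?P + e)" for n
        using infsumI[OF grad[of "n + N"]] J[of "n + N"] N[of "n + N"] by (simp add: J_def)
    qed auto
    then show "J w \<le> E m + e"
      using infsumI[OF grad_norm_has_sum[OF w(1)]] by (simp add: J_def)
  qed
  \<comment> \<open>A limit of mass 0 would be the zero function, whose energy 0 exceeds
    \<open>E m\<close>.\<close>
  moreover have "mass w \<noteq> 0"
    using mass_eq_0D[OF w(1)] J_zero neg[OF m] \<open>J w \<le> E m\<close> by auto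
  then have "mass w > 0" using mass_nonneg[of w] by simp
  \<comment> \<open>If \<open>mass w < m\<close>, then
    \<open>E m < E (mass w) \<le> J w \<le> E m\<close>.\<close>
  moreover note E_le[OF w(1)]
  ultimately show "mass w = m" "J w = E m"
    using E_strict_decreasing[OF neg, of "mass w" m] w(2) by fastforce+
  show "square_summable w" by (rule w(1))
qed

text \<open>At a zero next to a positive value, raising the function to \<open>s\<close> lowers the Dirichlet
  energy to first order in \<open>s\<close>, while potential, mass and the change of \<open>E\<close> are of second order.\<close>

lemma minimizer_positive:
  assumes w: "square_summable w" "mass w > 0" "\<And>x. w x \<ge> 0" and min: "J w = E (mass w)"
  shows "w x > 0"
proof (rule ccontr)
  assume "\<not> w x > 0"
  then have "w x = 0" using w(3)[of x] by simp
  \<comment> \<open>If all neighbours of zeros were zeros, connectedness would spread the zero at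
    \<open>x\<close> over the whole lattice.\<close>
  have "\<exists>a b. w a = 0 \<and> adjacent a b \<and> w b \<noteq> 0"
  proof (rule ccontr)
    assume "\<not> ?thesis"
    then have "w y = 0" for y
      using lattice_connected[of "\<lambda>y. w y = 0" x y] \<open>w x = 0\<close> by blast
    then have "w = (\<lambda>_. 0)" by blast
    with w(2) show False by (simp add: mass_zero)
  qed
  then obtain a b where ab: "w a = 0" "adjacent a b" "w b \<noteq> 0" by blast
  then have b: "w b > 0" using w(3)[of b] by simp
  obtain C where "C \<ge> 0" and C: "\<And>t. \<bar>t\<bar> \<le> 1 \<Longrightarrow> \<bar>F t\<bar> \<le> C * t\<^sup>2"
    using quadratic_bound[of 1] by blast
  obtain K where "K \<ge> 0" and K: "\<And>p n. 0 < p \<Longrightarrow> p \<le> mass w + 1 \<Longrightarrow> 0 < n \<Longrightarrow> n \<le> mass w + 1 \<Longrightarrow>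
      \<bar>E p - E n\<bar> \<le> K * \<bar>p - n\<bar>"
    using E_lipschitz[of "mass w + 1"] by blast
  define d where "d = real (card (unit_steps :: 'n lattice set))"
  \<comment> \<open>The second-order coefficients of the Dirichlet term, the potential and the
    change of \<open>E\<close>; the 1 makes \<open>L\<close> positive.\<close>
  define L where "L = d / 2 + C + K + 1"
  have L: "L > 0" using \<open>C \<ge> 0\<close> \<open>K \<ge> 0\<close> by (simp add: L_def d_def)
  \<comment> \<open>At most 1, so that the bounds with \<open>C\<close> and \<open>K\<close> apply;
    at most \<open>w b / (4 * L)\<close>, so that the second-order costs are at most half of the
    gain \<open>s * w b / 2\<close>.\<close>
  define s where "s = min 1 (w b / (4 * L))"
  have s: "0 < s" "s \<le> 1" "s \<le> w b / (4 * L)" using b L by (auto simp: s_def)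
  let ?v = "w(a := s)"
  have v: "square_summable ?v" "mass ?v = mass w + s\<^sup>2"
    using mass_update[OF w(1), of a s] ab(1) by auto
  have "dirichlet ?v \<le> dirichlet w + d * s\<^sup>2 - s * w b"
    unfolding d_def using w ab s by (intro dirichlet_update_zero) auto
  moreover have "(\<Sum>\<^sub>\<infinity>x. F (?v x)) = (\<Sum>\<^sub>\<infinity>x. F (w x)) + F s"
    using infsum_change_finite(2)[OF summable_F[OF w(1)], of "{a}" "\<lambda>x. F (?v x)"] ab(1)
    by (simp add: F_0)
  moreover have "\<bar>F s\<bar> \<le> C * s\<^sup>2" using C[of s] s by simp
  ultimately have "J ?v \<le> J w + d / 2 * s\<^sup>2 - s * w b / 2 + C * s\<^sup>2"
    unfolding J_def by (simp add: field_simps)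
  moreover have "E (mass w) \<le> E (mass ?v) + K * s\<^sup>2"
  proof -
    have "s\<^sup>2 \<le> 1" using s by (simp add: power_le_one)
    then show ?thesis
      using K[of "mass w" "mass ?v"] w(2) v(2) by (auto simp: add_pos_nonneg)
  qed
  ultimately have "s * w b / 2 \<le> (d / 2 + C + K) * s\<^sup>2"
    using E_le[OF v(1)] min by (simp add: algebra_simps)
  also have "\<dots> \<le> L * s\<^sup>2"
    by (intro mult_right_mono) (auto simp: L_def)
  also have "\<dots> = s * (L * s)" by (simp add: power2_eq_square)
  also have "\<dots> \<le> s * (w b / 4)"
    using s L by (intro mult_left_mono) (auto simp: field_simps)
  finally show False using s(1) b by simp
qed

end


section \<open>Rearrangement\<close>

lemma abs_le_lp_norm:
  assumes "z \<in> lp q" "q > 0" shows "\<bar>z x\<bar> \<le> lp_norm q z"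
proof -
  have "\<bar>z x\<bar> powr q \<le> (\<Sum>\<^sub>\<infinity>x. \<bar>z x\<bar> powr q)"
    using finite_sum_le_infsum[of "\<lambda>x. \<bar>z x\<bar> powr q" UNIV "{x}"] assms(1) by (simp add: lp_def)
  then have "(\<bar>z x\<bar> powr q) powr (1 / q) \<le> lp_norm q z"
    unfolding lp_norm_def using assms(2) by (intro powr_mono2) auto
  then show ?thesis using assms(2) by (simp add: powr_powr)
qed

lemma lp_diff:
  assumes "u \<in> lp q" "v \<in> lp q" "q \<ge> 0" shows "(\<lambda>x. u x - v x) \<in> lp q"
proof -
  have "\<bar>u x - v x\<bar> powr q \<le> 2 powr q * (\<bar>u x\<bar> powr q + \<bar>v x\<bar> powr q)" for x
  proof -
    have "\<bar>u x - v x\<bar> powr q \<le> (2 * max \<bar>u x\<bar> \<bar>v x\<bar>) powr q"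
      using assms(3) by (intro powr_mono2) auto
    also have "\<dots> = 2 powr q * max \<bar>u x\<bar> \<bar>v x\<bar> powr q" by (simp add: powr_mult)
    also have "max \<bar>u x\<bar> \<bar>v x\<bar> powr q \<le> \<bar>u x\<bar> powr q + \<bar>v x\<bar> powr q"
      by (auto simp: max_def)
    finally show ?thesis by simp
  qed
  moreover have "(\<lambda>x. 2 powr q * (\<bar>u x\<bar> powr q + \<bar>v x\<bar> powr q)) summable_on UNIV"
    using assms by (auto simp: lp_def intro!: summable_on_cmult_right summable_on_add)
  ultimately show ?thesis
    unfolding lp_def by (auto elim!: summable_on_real_comparison)
qed

lemma lp_4_if_square_summable:
  assumes "square_summable u" shows "u \<in> lp 4"
proof -
  have "\<bar>\<bar>u x\<bar> powr 4\<bar> \<le> mass u * (u x)\<^sup>2" for x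
  proof -
    have "\<bar>u x\<bar> powr 4 = (u x)\<^sup>2 * (u x)\<^sup>2"
      by (simp add: power2_eq_square power4_eq_xxxx)
    also have "\<dots> \<le> mass u * (u x)\<^sup>2"
      using sum_le_mass[OF assms, of "{x}"] by (intro mult_right_mono) auto
    finally show ?thesis by simp
  qed
  moreover have "(\<lambda>x. mass u * (u x)\<^sup>2) summable_on UNIV"
    using assms by (auto simp: square_summable_def intro: summable_on_cmult_right)
  ultimately show ?thesis
    unfolding lp_def by (auto elim!: summable_on_real_comparison)
qed

lemma admissible_if_square_summable:
  assumes "square_summable u" "\<And>x. u x \<ge> 0" shows "admissible u"
proof -
  have "\<bar>u x\<bar> = u x" for x using assms(2)[of x] by simp
  then show ?thesis
    using finite_superlevel[OF assms(1)] assms(2) by (auto simp: admissible_def)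
qed

lemma lp_norm_nonneg: "lp_norm p u \<ge> 0"
  by (simp add: lp_norm_def)

lemma lp_norm_2_eq: "lp_norm 2 u = sqrt (mass u)"
  using lp_norm_2_power2[of u] lp_norm_nonneg[of 2 u] real_sqrt_unique by metis

lemma mass_grad_norm: "square_summable u \<Longrightarrow> mass (grad_norm u) = dirichlet u"
  using infsumI[OF grad_norm_has_sum] by (simp add: mass_def)

context schwarz_rearrangement
begin

lemma equimeasurable_real:
  fixes g :: "real \<Rightarrow> real"
  assumes "admissible u" "g 0 = 0" "\<And>t. g t \<ge> 0" "(\<lambda>x. g (u x)) summable_on UNIV"
  shows "((\<lambda>x. g (R u x)) has_sum (\<Sum>\<^sub>\<infinity>x. g (u x))) UNIV"
proof -
  have *: "(\<Sum>\<^sub>\<infinity>x. ennreal (g (R u x))) = ennreal (\<Sum>\<^sub>\<infinity>x. g (u x))"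
    using equimeasurable[of g u] infsum_ennreal[OF assms(4)] assms(1-3) by simp
  have nn: "(\<Sum>\<^sub>\<infinity>x. g (u x)) \<ge> 0" "(\<Sum>\<^sub>\<infinity>x. g (R u x)) \<ge> 0"
    using assms(3) by (auto intro: infsum_nonneg)
  have s: "(\<lambda>x. g (R u x)) summable_on UNIV"
    by (rule summable_on_ennreal_bounded[OF * nn(1)]) (rule assms(3))
  with infsum_ennreal[OF this] * assms(3) nn show ?thesis
    by (simp add: has_sum_iff)
qed

lemma rearrangement_mass:
  assumes "square_summable u" "\<And>x. u x \<ge> 0"
  shows "square_summable (R u)" "mass (R u) = mass u"
  using equimeasurable_real[OF admissible_if_square_summable[OF assms], of "\<lambda>t. t\<^sup>2"] assms(1)
  by (auto simp: square_summable_def mass_def has_sum_iff)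

lemma rearrangement_dirichlet:
  assumes "square_summable u" "\<And>x. u x \<ge> 0"
  shows "dirichlet (R u) \<le> dirichlet u"
  using polya_szego[of u] assms rearrangement_mass(1)[OF assms]
  by (simp add: lp_2_iff lp_norm_2_eq mass_grad_norm)

text \<open>Equimeasurability only covers non-negative functions, so it is applied to the positive and
  the negative part separately.\<close>

lemma rearrangement_infsum:
  fixes g :: "real \<Rightarrow> real"
  assumes "admissible u" "g 0 = 0" "(\<lambda>x. g (u x)) summable_on UNIV"
  shows "(\<Sum>\<^sub>\<infinity>x. g (R u x)) = (\<Sum>\<^sub>\<infinity>x. g (u x))"
proof -
  have abs: "(\<lambda>x. \<bar>g (u x)\<bar>) summable_on UNIV"
    using assms(3) summable_on_iff_abs_summable_on_real[of "\<lambda>x. g (u x)"] by simp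
  define p where "p t = max (g t) 0" for t
  define q where "q t = max (- g t) 0" for t
  have s: "(\<lambda>x. p (u x)) summable_on UNIV" "(\<lambda>x. q (u x)) summable_on UNIV"
    by (rule summable_on_real_comparison[OF abs], simp add: p_def q_def)+
  have "((\<lambda>x. p (R u x)) has_sum (\<Sum>\<^sub>\<infinity>x. p (u x))) UNIV"
    "((\<lambda>x. q (R u x)) has_sum (\<Sum>\<^sub>\<infinity>x. q (u x))) UNIV"
    by (rule equimeasurable_real[OF assms(1)]; simp add: p_def q_def assms(2) s[unfolded p_def q_def])+
  then have "(\<Sum>\<^sub>\<infinity>x. p (R u x) - q (R u x)) = (\<Sum>\<^sub>\<infinity>x. p (u x)) - (\<Sum>\<^sub>\<infinity>x. q (u x))"
    by (subst infsum_diff_real) (auto simp: has_sum_iff)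
  also have "\<dots> = (\<Sum>\<^sub>\<infinity>x. p (u x) - q (u x))"
    by (rule infsum_diff_real[OF s, symmetric])
  moreover have "p t - q t = g t" for t by (simp add: p_def q_def max_def)
  ultimately show ?thesis by simp
qed

end

text \<open>Passing to the absolute value lowers the Dirichlet term by the reverse triangle
  inequality and raises the potential by the assumption on \<open>F\<close>; rearranging lowers the
  Dirichlet term again and preserves the potential.\<close>

lemma (in subquadratic) rearranged_energy:
  assumes R: "schwarz_rearrangement R" and F: "\<And>t. F t \<le> F \<bar>t\<bar>" and u: "square_summable u"
  defines "v \<equiv> R (\<lambda>x. \<bar>u x\<bar>)"
  shows "square_summable v" "mass v = mass u" "J v \<le> J u" "schwarz_symmetric R v"
proof -
  interpret schwarz_rearrangement R by (rule R)
  let ?a = "\<lambda>x. \<bar>u x\<bar>"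
  have a: "square_summable ?a" "mass ?a = mass u"
    using u by (auto simp: square_summable_def mass_def)
  have adm: "admissible ?a" by (rule admissible_if_square_summable[OF a(1)]) simp
  show "square_summable v" "mass v = mass u"
    using rearrangement_mass[OF a(1)] a(2) by (auto simp: v_def)
  show "schwarz_symmetric R v"
    using maps_admissible[OF adm] idempotent[OF adm] by (simp add: schwarz_symmetric_def v_def)
  have "dirichlet v \<le> dirichlet u"
    using rearrangement_dirichlet[OF a(1)] dirichlet_abs_le[OF u] by (simp add: v_def)
  moreover have "(\<Sum>\<^sub>\<infinity>x. F (v x)) = (\<Sum>\<^sub>\<infinity>x. F (?a x))"
    unfolding v_def by (rule rearrangement_infsum[OF adm F_0 summable_F[OF a(1)]])
  moreover have "(\<Sum>\<^sub>\<infinity>x. F (u x)) \<le> (\<Sum>\<^sub>\<infinity>x. F (?a x))"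
    by (intro infsum_mono summable_F u a(1) F)
  ultimately show "J v \<le> J u" by (simp add: J_def)
qed

lemma (in subquadratic) exists_symmetric_minimizer:
  assumes neg: "\<And>m. m > 0 \<Longrightarrow> E m < 0" and m: "m > 0"
    and R: "schwarz_rearrangement R" and F: "\<And>t. F t \<le> F \<bar>t\<bar>"
  obtains w where "square_summable w" "mass w = m" "J w = E m" "\<And>x. w x > 0" "schwarz_symmetric R w"
proof -
  interpret schwarz_rearrangement R by (rule R)
  have "\<exists>u. square_summable u \<and> mass u = m \<and> J u < E m + inverse (real (Suc n))" for n
    using E_approx[of m "inverse (real (Suc n))"] m by (metis inverse_positive_iff_positive less_imp_le of_nat_0_less_iff zero_less_Suc)
  then obtain u where u: "\<And>n. square_summable (u n)" "\<And>n. mass (u n) = m"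
      "\<And>n. J (u n) < E m + inverse (real (Suc n))"
    by metis
  define v where "v n = R (\<lambda>x. \<bar>u n x\<bar>)" for n
  have v: "square_summable (v n)" "mass (v n) = m" "J (v n) \<le> E m + inverse (real (Suc n))"
      "schwarz_symmetric R (v n)" for n
    using rearranged_energy[OF R F u(1)[of n]] u(2)[of n] u(3)[of n] by (auto simp: v_def)
  \<comment> \<open>The exponent 4 is a convenient one above 2: the fourth power of a value is at
    most the mass times its square, so square-summable functions lie in \<open>lp 4\<close>.\<close>
  obtain r w where r: "strict_mono r" and w4: "w \<in> lp 4"
    and conv: "(\<lambda>n. lp_norm 4 (\<lambda>x. v (r n) x - w x)) \<longlonglongrightarrow> 0"
    using compact_embedding[of 2 4 v "sqrt m"] v by (auto simp: lp_2_iff lp_norm_2_eq)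
  have unif: "\<forall>\<^sub>F n in sequentially. \<forall>x. \<bar>v (r n) x - w x\<bar> \<le> e" if "e > 0" for e
  proof -
    have "\<forall>\<^sub>F n in sequentially. lp_norm 4 (\<lambda>x. v (r n) x - w x) < e"
      using conv that by (rule order_tendstoD)
    then show ?thesis
    proof eventually_elim
      case (elim n)
      have "(\<lambda>x. v (r n) x - w x) \<in> lp 4"
        by (intro lp_diff lp_4_if_square_summable v(1) w4) simp
      from abs_le_lp_norm[OF this] elim show ?case by (auto intro: less_imp_le order_le_less_trans)
    qed
  qed
  have "(\<lambda>n. inverse (real (Suc (r n)))) \<longlonglongrightarrow> 0"
    using LIMSEQ_subseq_LIMSEQ[OF LIMSEQ_inverse_real_of_nat r] by (simp add: comp_def)
  from uniform_limit_minimizer[OF neg m v(1) v(2) v(3) this unif]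
  have w: "square_summable w" "mass w = m" "J w = E m" by auto
  note lim = uniform_limit_pointwise[OF unif]
  have nonneg: "w x \<ge> 0" for x
  proof (rule LIMSEQ_le_const[OF lim])
    show "\<exists>N. \<forall>n\<ge>N. 0 \<le> v (r n) x"
      using v(4) by (auto simp: schwarz_symmetric_def admissible_def)
  qed
  have "schwarz_symmetric R w"
    using closed_pointwise[of "\<lambda>n. v (r n)" w] v(4) lim admissible_if_square_summable[OF w(1) nonneg]
    by blast
  moreover have "w x > 0" for x
    using minimizer_positive[OF w(1) _ nonneg] w m by simp
  ultimately show thesis using that w by blast
qed


section \<open>Negative energy\<close>

definition cube :: "int \<Rightarrow> 'n::finite lattice set" where
  "cube r = {x. \<forall>i. \<bar>x $ i\<bar> \<le> r}"

lemma cube_card: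
  assumes "r \<ge> 0"
  shows "finite (cube r :: 'n::finite lattice set)"
    "card (cube r :: 'n lattice set) = nat (2 * r + 1) ^ CARD('n)"
proof -
  have eq: "(cube r :: 'n lattice set) = vec_lambda ` (UNIV \<rightarrow>\<^sub>E {- r..r})"
  proof (intro equalityI subsetI)
    fix x :: "'n lattice" assume "x \<in> cube r"
    then have "vec_nth x \<in> UNIV \<rightarrow>\<^sub>E {- r..r}" by (auto simp: cube_def abs_le_iff PiE_def) (smt (verit))
    moreover have "x = vec_lambda (vec_nth x)" by simp
    ultimately show "x \<in> vec_lambda ` (UNIV \<rightarrow>\<^sub>E {- r..r})" by blast
  next
    fix x :: "'n lattice" assume "x \<in> vec_lambda ` (UNIV \<rightarrow>\<^sub>E {- r..r})"
    then obtain g where "x = vec_lambda g" "\<And>i. g i \<in> {- r..r}" by (auto simp: PiE_def Pi_def)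
    then show "x \<in> cube r" by (auto simp: cube_def abs_le_iff) (smt (verit))
  qed
  have inj: "inj_on vec_lambda (UNIV \<rightarrow>\<^sub>E {- r..r} :: ('n \<Rightarrow> int) set)"
    by (auto intro!: inj_onI simp: vec_lambda_inject)
  show "finite (cube r :: 'n lattice set)"
    unfolding eq by (intro finite_imageI finite_PiE) auto
  show "card (cube r :: 'n lattice set) = nat (2 * r + 1) ^ CARD('n)"
    unfolding eq card_image[OF inj] by (simp add: card_PiE)
qed

definition l1_norm :: "'n::finite lattice \<Rightarrow> int" where
  "l1_norm x = (\<Sum>i\<in>UNIV. \<bar>x $ i\<bar>)"

lemma l1_norm_adjacent: "e \<in> unit_steps \<Longrightarrow> \<bar>l1_norm (x + e) - l1_norm x\<bar> \<le> 1"
proof -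
  assume "e \<in> unit_steps"
  then have "(\<Sum>i\<in>UNIV. \<bar>e $ i\<bar>) = 1" by (simp add: unit_steps_def adjacent_def)
  moreover have "\<bar>l1_norm (x + e) - l1_norm x\<bar> = \<bar>\<Sum>i\<in>UNIV. \<bar>(x + e) $ i\<bar> - \<bar>x $ i\<bar>\<bar>"
    by (simp add: l1_norm_def sum_subtractf)
  moreover have "\<dots> \<le> (\<Sum>i\<in>UNIV. \<bar>e $ i\<bar>)"
    by (rule order_trans[OF sum_abs]) (auto intro: sum_mono)
  ultimately show ?thesis by simp
qed

text \<open>The tent over a ball of the graph metric: it changes by at most 1 along every edge, so
  its Dirichlet energy is bounded by counting points of the cube containing its support.\<close>

definition cone :: "int \<Rightarrow> 'n::finite lattice \<Rightarrow> real" where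
  "cone k x = real_of_int (max 0 (k - l1_norm x))"

lemma cone_bounds:
  assumes "k \<ge> 0" shows "0 \<le> cone k x" "cone k x \<le> real_of_int k"
proof -
  have "l1_norm x \<ge> 0" by (simp add: l1_norm_def sum_nonneg)
  then show "0 \<le> cone k x" "cone k x \<le> real_of_int k" using assms by (auto simp: cone_def)
qed

lemma l1_norm_outside_cube: "x \<notin> cube k \<Longrightarrow> l1_norm x \<ge> k + 1"
proof -
  assume "x \<notin> cube k"
  then obtain i where "\<bar>x $ i\<bar> > k" by (auto simp: cube_def not_le)
  moreover have "\<bar>x $ i\<bar> \<le> l1_norm x"
    unfolding l1_norm_def by (rule member_le_sum) auto
  ultimately show ?thesis by simp
qed

lemma cone_outside_cube: "x \<notin> cube k \<Longrightarrow> cone k x = 0"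
  using l1_norm_outside_cube[of x k] by (simp add: cone_def)

text \<open>The graph norm on \<open>cube r\<close> is at most \<open>CARD('n) * r\<close>, half the
  height of the cone. Thus the cone keeps half its height on a cube whose size is a fixed proportion
  of the support.\<close>

lemma cone_inner_cube:
  assumes "x \<in> cube r" shows "cone (2 * (int CARD('n) * r)) (x :: 'n::finite lattice) \<ge> real CARD('n) * real_of_int r"
proof -
  have "l1_norm x \<le> (\<Sum>i\<in>(UNIV :: 'n set). r)"
    unfolding l1_norm_def using assms by (intro sum_mono) (auto simp: cube_def)
  then have "int CARD('n) * r \<le> max 0 (2 * (int CARD('n) * r) - l1_norm x)" by simp
  then have "real_of_int (int CARD('n) * r) \<le> cone (2 * (int CARD('n) * r)) x"
    unfolding cone_def by (simp only: of_int_le_iff)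
  then show ?thesis by simp
qed

lemma cone_mass:
  assumes "k \<ge> 0"
  shows "square_summable (cone k :: 'n::finite lattice \<Rightarrow> real)"
    "mass (cone k :: 'n lattice \<Rightarrow> real) \<le> (real_of_int k)\<^sup>2 * real (card (cube k :: 'n lattice set))"
    "dirichlet (cone k :: 'n lattice \<Rightarrow> real) \<le>
      real (card (unit_steps :: 'n lattice set)) * real (card (cube k :: 'n lattice set)) / 2"
proof -
  let ?B = "cube k :: 'n lattice set"
  have fin: "finite ?B" by (rule cube_card(1)[OF assms])
  show "square_summable (cone k :: 'n lattice \<Rightarrow> real)"
    by (intro square_summable_finitely_supported)
       (use cone_outside_cube[where k = k] in \<open>auto simp: finitely_supported_def intro: finite_subset[OF _ fin]\<close>)
  have "mass (cone k :: 'n lattice \<Rightarrow> real) = (\<Sum>x\<in>?B. (cone k x)\<^sup>2)"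
    by (rule mass_finitely_supported[OF fin]) (rule cone_outside_cube)
  also have "\<dots> \<le> (\<Sum>x\<in>?B. (real_of_int k)\<^sup>2)"
    by (intro sum_mono power_mono cone_bounds assms)
  finally show "mass (cone k :: 'n lattice \<Rightarrow> real) \<le> (real_of_int k)\<^sup>2 * real (card ?B)"
    by (simp add: mult.commute)
  have "mass (\<lambda>x. cone k (x + e) - cone k x) \<le> real (card ?B)" if e: "e \<in> unit_steps" for e :: "'n lattice"
  proof -
    have "mass (\<lambda>x. cone k (x + e) - cone k x) = (\<Sum>x\<in>?B. (cone k (x + e) - cone k x)\<^sup>2)"
    proof (rule mass_finitely_supported[OF fin])
      \<comment> \<open>The graph norm is at least \<open>k + 1\<close> at \<open>x\<close>, hence
        at least \<open>k\<close> at \<open>x + e\<close>, where the cone vanishes as well.\<close>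
      fix x assume "x \<notin> ?B"
      with l1_norm_outside_cube[OF this] l1_norm_adjacent[OF e, of x]
      show "cone k (x + e) - cone k x = 0" by (simp add: cone_def)
    qed
    also have "\<dots> \<le> (\<Sum>x\<in>?B. 1\<^sup>2)"
    proof (rule sum_mono)
      fix x
      have "\<bar>max 0 (k - l1_norm (x + e)) - max 0 (k - l1_norm x)\<bar> \<le> 1"
        using l1_norm_adjacent[OF e, of x] by linarith
      then have "real_of_int \<bar>max 0 (k - l1_norm (x + e)) - max 0 (k - l1_norm x)\<bar> \<le> 1"
        by (simp only: of_int_le_1_iff)
      then have "\<bar>cone k (x + e) - cone k x\<bar> \<le> 1"
        unfolding cone_def by (simp only: of_int_abs of_int_diff)
      then show "(cone k (x + e) - cone k x)\<^sup>2 \<le> 1\<^sup>2"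
        by (simp only: abs_le_square_iff[symmetric] abs_one)
    qed
    finally show ?thesis by simp
  qed
  then have "(\<Sum>e\<in>(unit_steps :: 'n lattice set). mass (\<lambda>x. cone k (x + e) - cone k x)) \<le>
      (\<Sum>e\<in>(unit_steps :: 'n lattice set). real (card ?B))"
    by (rule sum_mono)
  then show "dirichlet (cone k :: 'n lattice \<Rightarrow> real) \<le>
      real (card (unit_steps :: 'n lattice set)) * real (card ?B) / 2"
    by (simp add: dirichlet_def)
qed

text \<open>The test functions are cones of mass \<open>m\<close> spread over a cube of side proportional to \<open>j\<close>. Their
  height is of order \<open>j powr (- N / 2)\<close>, so kinetic energy and the integral of the critical power
  \<open>2 + 4 / N\<close> both scale like \<open>j powr (- 2)\<close>.\<close>

lemma (in subquadratic) E_negative: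
  assumes growth: "filterlim (\<lambda>t. F t / \<bar>t\<bar> powr (2 + 4 / real CARD('n))) at_top (at 0)"
    and m: "m > 0"
  shows "E m < 0"
proof -
  define N where "N = CARD('n)"
  have N: "N \<ge> 1" by (simp add: N_def Suc_leI)
  define p where "p = 2 + 4 / real N"
  \<comment> \<open>Makes \<open>G * real j ^ N / 2\<close> a bound for the Dirichlet energy of the
    cone: the cube around its support has at most \<open>(5 * real N * real j) ^ N\<close> points,
    each contributing at most 1 per direction.\<close>
  define G where "G = real (card (unit_steps :: 'n lattice set)) * (5 * real N) ^ N"
  have "G \<ge> 0" by (simp add: G_def)
  \<comment> \<open>The scaled cone will satisfy
    \<open>(a * L)\<^sup>2 \<ge> (m / 4) / (5 * L) ^ N\<close>; raised to the power
    \<open>2 / real N\<close>, the right-hand side is \<open>c / L\<^sup>2\<close>.\<close>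
  define c where "c = (m / 4) powr (2 / real N) / 25"
  have "c > 0" using m by (simp add: c_def)
  \<comment> \<open>In units of \<open>a\<^sup>2 * real j ^ N\<close>, the kinetic energy is at most
    \<open>G / 4\<close> and the potential at least \<open>K * c\<close>, which equals
    \<open>G / 4 + c\<close>.\<close>
  define K where "K = G / (4 * c) + 1"
  have "K > 0" using \<open>G \<ge> 0\<close> \<open>c > 0\<close> by (simp add: K_def add_nonneg_pos)
  have "\<forall>\<^sub>F t in at 0. K \<le> F t / \<bar>t\<bar> powr p"
    using growth unfolding filterlim_at_top p_def N_def by blast
  then obtain \<delta> where "\<delta> > 0" and \<delta>: "\<And>t. t \<noteq> 0 \<Longrightarrow> \<bar>t\<bar> < \<delta> \<Longrightarrow> K \<le> F t / \<bar>t\<bar> powr p"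
    unfolding eventually_at by (auto simp: dist_real_def)
  have F_ge: "F t \<ge> K * t powr p" if "0 \<le> t" "t < \<delta>" for t
  proof (cases "t = 0")
    case False
    with that have "K \<le> F t / t powr p" using \<delta>[of t] by simp
    then show ?thesis using that False by (simp add: pos_le_divide_eq)
  qed (simp add: F_0)
  \<comment> \<open>The squared peak of the scaled cone is at most \<open>4 * m / real j\<close>; it
    has to stay below \<open>\<delta>\<^sup>2\<close> for the growth bound to apply
    everywhere.\<close>
  obtain j :: nat where j: "4 * m / \<delta>\<^sup>2 < real j" using reals_Archimedean2 by blast
  have "0 < 4 * m / \<delta>\<^sup>2" using m \<open>\<delta> > 0\<close> by simp
  with j have j1: "j \<ge> 1" by (cases j) auto
  define L where "L = real N * real j"
  have L: "L \<ge> 1" using N j1 mult_mono[of 1 "real N" 1 "real j"] by (simp add: L_def)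
  define k where "k = 2 * (int N * int j)"
  have k: "k \<ge> 0" "real_of_int k = 2 * L" by (auto simp: k_def L_def)
  define \<phi> where "\<phi> = (cone k :: 'n lattice \<Rightarrow> real)"
  define A where "A = mass \<phi>"
  have "real (card (cube k :: 'n lattice set)) = (2 * real_of_int k + 1) ^ N"
    using cube_card(2)[OF k(1), where 'n = 'n] k(1) by (simp add: N_def)
  also have "\<dots> \<le> (5 * L) ^ N"
    using k L by (intro power_mono) auto
  finally have card_k: "real (card (cube k :: 'n lattice set)) \<le> (5 * L) ^ N" .
  have ss: "square_summable \<phi>" unfolding \<phi>_def by (rule cone_mass(1)[OF k(1)])
  have "A \<le> (2 * L)\<^sup>2 * real (card (cube k :: 'n lattice set))"
    using cone_mass(2)[OF k(1), where 'n = 'n] k(2) by (simp add: A_def \<phi>_def)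
  also have "\<dots> \<le> (2 * L)\<^sup>2 * (5 * L) ^ N"
    by (intro mult_left_mono card_k) simp
  finally have A_le: "A \<le> 4 * L\<^sup>2 * (5 * L) ^ N" by (simp add: power_mult_distrib)
  let ?B = "cube (int j) :: 'n lattice set"
  have B: "finite ?B" by (rule cube_card(1)) simp
  have "real (card ?B) = (2 * real j + 1) ^ N"
    using cube_card(2)[of "int j", where 'n = 'n] by (simp add: N_def nat_add_distrib nat_mult_distrib add_ac)
  then have card_B: "real j ^ N \<le> real (card ?B)" by (auto intro: power_mono)
  have inner: "\<phi> x \<ge> L" if "x \<in> ?B" for x
    using cone_inner_cube[OF that] by (simp add: \<phi>_def k_def L_def N_def)
  \<comment> \<open>On the inner cube the cone keeps at least half its height, which bounds its mass
    from below.\<close>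
  have "L\<^sup>2 * real j ^ N \<le> L\<^sup>2 * real (card ?B)"
    by (intro mult_left_mono card_B) simp
  also have "\<dots> = (\<Sum>x\<in>?B. L\<^sup>2)" by simp
  also have "\<dots> \<le> (\<Sum>x\<in>?B. (\<phi> x)\<^sup>2)"
    using inner L by (intro sum_mono power_mono) auto
  also have "\<dots> \<le> A" unfolding A_def by (rule sum_le_mass[OF ss B])
  finally have A_ge: "L\<^sup>2 * real j ^ N \<le> A" .
  have jN: "real j ^ N > 0" using j1 by simp
  have "A > 0" by (rule less_le_trans[OF _ A_ge]) (use L jN in simp)
  define a where "a = sqrt (m / A)"
  have a: "a > 0" "a\<^sup>2 = m / A" using m \<open>A > 0\<close> by (auto simp: a_def)
  let ?u = "\<lambda>x. a * \<phi> x"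
  have u: "square_summable ?u" "mass ?u = m"
    using square_summable_cmult[OF ss, of a] a \<open>A > 0\<close> by (auto simp: mass_cmult A_def)
  have "(a * (2 * L))\<^sup>2 < \<delta>\<^sup>2"
  proof -
    have "(a * (2 * L))\<^sup>2 = 4 * m * L\<^sup>2 / A" by (simp add: power_mult_distrib a(2))
    also have "\<dots> \<le> 4 * m * L\<^sup>2 / (L\<^sup>2 * real j ^ N)"
      using m L jN A_ge \<open>A > 0\<close> by (intro divide_left_mono) auto
    also have "\<dots> = 4 * m / real j ^ N" using L by simp
    also have "\<dots> \<le> 4 * m / real j"
      using m j1 N self_le_power[of "real j" N] by (intro divide_left_mono) auto
    also have "\<dots> < \<delta>\<^sup>2" using j j1 \<open>\<delta> > 0\<close> by (simp add: field_simps)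
    finally show ?thesis .
  qed
  then have top: "a * (2 * L) < \<delta>" using \<open>\<delta> > 0\<close> power2_less_imp_less by fastforce
  have range: "0 \<le> ?u x" "?u x < \<delta>" for x
  proof -
    have "0 \<le> \<phi> x" "\<phi> x \<le> 2 * L" using cone_bounds[OF k(1), of x] k(2) by (auto simp: \<phi>_def)
    then have "0 \<le> ?u x" and le: "?u x \<le> a * (2 * L)"
      using a(1) by (auto intro: mult_left_mono)
    then show "0 \<le> ?u x" by simp
    show "?u x < \<delta>" using le top by (rule order_le_less_trans)
  qed
  have F_nonneg: "F (?u x) \<ge> 0" for x
    using F_ge[OF range, of x] \<open>K > 0\<close> by (smt (verit) mult_nonneg_nonneg powr_ge_zero)
  \<comment> \<open>Criticality of the exponent enters here: \<open>(a * L) powr p\<close> is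
    \<open>(a * L)\<^sup>2\<close> times the right-hand side, and the bound
    \<open>c / L\<^sup>2\<close> cancels \<open>L\<close>, leaving a multiple of
    \<open>a\<^sup>2\<close>, the order of the Dirichlet energy per point.\<close>
  have "c / L\<^sup>2 \<le> ((a * L)\<^sup>2) powr (2 / real N)"
  proof -
    have "(m / 4) / (5 * L) ^ N \<le> (a * L)\<^sup>2"
    proof -
      have "m * L\<^sup>2 / (4 * L\<^sup>2 * (5 * L) ^ N) \<le> m * L\<^sup>2 / A"
        using A_le \<open>A > 0\<close> m L by (intro divide_left_mono) auto
      then show ?thesis using L a(2) by (simp add: power_mult_distrib)
    qed
    then have "((m / 4) / (5 * L) ^ N) powr (2 / real N) \<le> ((a * L)\<^sup>2) powr (2 / real N)"
      using m L by (intro powr_mono2) auto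
    moreover have "((5 * L) ^ N) powr (2 / real N) = 25 * L\<^sup>2"
    proof -
      have "(5 * L) ^ N = (5 * L) powr real N" using L by (simp add: powr_realpow)
      then have "((5 * L) ^ N) powr (2 / real N) = (5 * L) powr (real N * (2 / real N))"
        by (simp only: powr_powr)
      also have "\<dots> = (5 * L) powr 2" using N by simp
      also have "\<dots> = 25 * L\<^sup>2" using L by (simp add: powr_numeral power_mult_distrib)
      finally show ?thesis .
    qed
    moreover have "((m / 4) / (5 * L) ^ N) powr (2 / real N) =
        (m / 4) powr (2 / real N) / ((5 * L) ^ N) powr (2 / real N)"
      by (rule powr_divide)
    ultimately show ?thesis unfolding c_def by (simp only: divide_divide_eq_left)
  qed
  then have "K * ((a * L)\<^sup>2 * (c / L\<^sup>2)) \<le> K * ((a * L)\<^sup>2 * ((a * L)\<^sup>2) powr (2 / real N))"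
    using \<open>K > 0\<close> by (intro mult_left_mono) auto
  also have "(a * L)\<^sup>2 * ((a * L)\<^sup>2) powr (2 / real N) = (a * L) powr p"
  proof -
    have "a * L > 0" using a L by simp
    then have "(a * L)\<^sup>2 = (a * L) powr 2" by simp
    then have "(a * L)\<^sup>2 * ((a * L)\<^sup>2) powr (2 / real N) = (a * L) powr (2 + 2 * (2 / real N))"
      by (simp only: powr_add powr_powr)
    then show ?thesis by (simp add: p_def)
  qed
  finally have "K * (a\<^sup>2 * c) \<le> K * (a * L) powr p"
    using L by (simp add: power_mult_distrib)
  also have "\<dots> \<le> K * ?u x powr p" if "x \<in> ?B" for x
    using \<open>K > 0\<close> a(1) L inner[OF that] by (intro mult_left_mono powr_mono2) (auto simp: p_def)
  also have "K * ?u x powr p \<le> F (?u x)" for x by (rule F_ge[OF range])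
  finally have F_B: "K * (a\<^sup>2 * c) \<le> F (?u x)" if "x \<in> ?B" for x using that by blast
  have "K * c * a\<^sup>2 * real j ^ N \<le> (K * (a\<^sup>2 * c)) * real (card ?B)"
    using mult_left_mono[OF card_B, of "K * (a\<^sup>2 * c)"] \<open>K > 0\<close> \<open>c > 0\<close> by (simp add: mult_ac)
  also have "\<dots> = (\<Sum>x\<in>?B. K * (a\<^sup>2 * c))" by simp
  also have "\<dots> \<le> (\<Sum>x\<in>?B. F (?u x))" by (intro sum_mono F_B)
  also have "\<dots> \<le> (\<Sum>\<^sub>\<infinity>x. F (?u x))"
    by (rule finite_sum_le_infsum[OF summable_F[OF u(1)] B]) (auto simp: F_nonneg)
  finally have P: "K * c * a\<^sup>2 * real j ^ N \<le> (\<Sum>\<^sub>\<infinity>x. F (?u x))" .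
  have "dirichlet \<phi> \<le> real (card (unit_steps :: 'n lattice set)) * (5 * L) ^ N / 2"
    using cone_mass(3)[OF k(1), where 'n = 'n] mult_left_mono[OF card_k, of "real (card (unit_steps :: 'n lattice set))"]
    by (simp add: \<phi>_def)
  also have "\<dots> = G * real j ^ N / 2" by (simp add: G_def L_def power_mult_distrib)
  finally have "a\<^sup>2 * dirichlet \<phi> \<le> a\<^sup>2 * (G * real j ^ N / 2)"
    by (rule mult_left_mono) simp
  then have "dirichlet ?u \<le> G * a\<^sup>2 * real j ^ N / 2" by (simp add: dirichlet_cmult mult_ac)
  moreover have "K * c = G / 4 + c" using \<open>c > 0\<close> by (simp add: K_def field_simps)
  ultimately have "J ?u \<le> G * a\<^sup>2 * real j ^ N / 4 - (G / 4 + c) * a\<^sup>2 * real j ^ N"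
    using P unfolding J_def by simp
  also have "\<dots> = - (c * a\<^sup>2 * real j ^ N)" by (simp add: algebra_simps)
  also have "\<dots> < 0" using \<open>c > 0\<close> a(1) jN by simp
  finally show ?thesis using E_le[OF u(1)] u(2) by simp
qed


section \<open>The original problem\<close>

lemma primitive_has_derivative:
  assumes "continuous_on UNIV f" shows "(primitive f has_real_derivative f t) (at t)"
proof -
  let ?b = "\<bar>t\<bar> + 1"
  \<comment> \<open>One symmetric interval contains 0 and has \<open>t\<close> in its interior, so
    the sign of \<open>t\<close> needs no case distinction.\<close>
  have "((\<lambda>u. LBINT \<tau>=ereal 0..ereal u. f \<tau>) has_vector_derivative f t) (at t within {- ?b..?b})"
    by (rule interval_integral_FTC2) (auto intro: continuous_on_subset[OF assms])
  moreover have "at t within {- ?b..?b} = at t"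
    by (rule at_within_interior) auto
  ultimately show ?thesis
    by (simp add: primitive_def[abs_def] has_real_derivative_iff_has_vector_derivative)
qed

lemma primitive_0: "primitive f 0 = 0"
  by (simp add: primitive_def)

text \<open>The mean value theorem reduces both properties to bounds for \<open>f\<close>: a small
  slope near 0, and on bounded sets a linear bound, which holds near 0 by the limit and elsewhere by
  compactness.\<close>

lemma subquadratic_primitive:
  assumes cont: "continuous_on UNIV f" and lim: "((\<lambda>t. f t / t) \<longlongrightarrow> 0) (at 0)"
  shows "subquadratic (primitive f)"
proof -
  have small_f: "\<exists>d>0. \<forall>t. t \<noteq> 0 \<longrightarrow> \<bar>t\<bar> \<le> d \<longrightarrow> \<bar>f t\<bar> \<le> e * \<bar>t\<bar>" if "e > 0" for e
  proof -
    have "\<forall>\<^sub>F t in at 0. \<bar>f t / t\<bar> < e"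
      using tendstoD[OF lim that] by (simp add: dist_real_def)
    then obtain d where d: "d > 0" "\<And>t. t \<noteq> 0 \<Longrightarrow> \<bar>t\<bar> < d \<Longrightarrow> \<bar>f t / t\<bar> < e"
      unfolding eventually_at by (auto simp: dist_real_def)
    have "\<bar>f t\<bar> \<le> e * \<bar>t\<bar>" if "t \<noteq> 0" "\<bar>t\<bar> \<le> d / 2" for t
      using d(2)[of t] d(1) that by (simp add: abs_divide pos_divide_less_eq)
    then show ?thesis using d(1) by (intro exI[of _ "d / 2"]) auto
  qed
  have mvt: "\<exists>z. \<bar>z\<bar> \<le> max \<bar>s\<bar> \<bar>t\<bar> \<and> \<bar>primitive f s - primitive f t\<bar> = \<bar>f z\<bar> * \<bar>s - t\<bar>" for s t
  proof -
    have *: "\<exists>z. \<bar>z\<bar> \<le> max \<bar>a\<bar> \<bar>b\<bar> \<and> \<bar>primitive f b - primitive f a\<bar> = \<bar>f z\<bar> * \<bar>b - a\<bar>"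
      if ab: "a < b" for a b
    proof -
      obtain z where "a < z" "z < b" "primitive f b - primitive f a = (b - a) * f z"
        using MVT2[OF ab, of "primitive f" f] primitive_has_derivative[OF cont] by blast
      then show ?thesis by (intro exI[of _ z]) (auto simp: abs_mult)
    qed
    show ?thesis
    proof (cases s t rule: linorder_cases)
      case less then show ?thesis using *[of s t] by (simp add: abs_minus_commute max.commute)
    next
      case equal then show ?thesis by (intro exI[of _ s]) auto
    next
      case greater then show ?thesis using *[of t s] by (simp add: max.commute)
    qed
  qed
  \<comment> \<open>The limit does not see the value at 0; continuity supplies it.\<close>
  have f_0: "f 0 = 0"
  proof -
    have "((\<lambda>t. f t / t * t) \<longlongrightarrow> 0 * 0) (at 0)"
      by (intro tendsto_mult lim tendsto_ident_at)
    moreover have "\<forall>\<^sub>F t in at 0. f t / t * t = f t"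
      by (simp add: eventually_at_filter)
    ultimately have "(f \<longlongrightarrow> 0) (at 0)" by (simp add: tendsto_cong)
    moreover have "(f \<longlongrightarrow> f 0) (at 0)"
      using cont by (simp add: continuous_on_def)
    ultimately show ?thesis using tendsto_unique by force
  qed
  have bound: "\<exists>C\<ge>0. \<forall>t. \<bar>t\<bar> \<le> M \<longrightarrow> \<bar>f t\<bar> \<le> C * \<bar>t\<bar>" for M
  proof -
    obtain d where d: "d > 0" "\<And>t. t \<noteq> 0 \<Longrightarrow> \<bar>t\<bar> \<le> d \<Longrightarrow> \<bar>f t\<bar> \<le> 1 * \<bar>t\<bar>"
      using small_f[of 1] by auto
    have "compact (f ` {- M..M})"
      by (intro compact_continuous_image continuous_on_subset[OF cont]) auto
    then obtain B where B: "\<And>t. t \<in> {- M..M} \<Longrightarrow> norm (f t) \<le> B"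
      using compact_imp_bounded bounded_iff by (metis imageI)
    \<comment> \<open>Slope 1 suffices up to \<open>d\<close>; beyond \<open>d\<close>, the bound
      \<open>B\<close> is at most \<open>\<bar>B\<bar> / d\<close> times the absolute value of
      \<open>t\<close>.\<close>
    have "\<bar>f t\<bar> \<le> (1 + \<bar>B\<bar> / d) * \<bar>t\<bar>" if t: "\<bar>t\<bar> \<le> M" for t
    proof (cases "\<bar>t\<bar> \<le> d")
      case True
      have "\<bar>f t\<bar> \<le> 1 * \<bar>t\<bar>" using d(2)[of t] True f_0 by (cases "t = 0") auto
      also have "\<dots> \<le> (1 + \<bar>B\<bar> / d) * \<bar>t\<bar>" using d(1) by (intro mult_right_mono) auto
      finally show ?thesis .
    next
      case False
      have "\<bar>f t\<bar> \<le> \<bar>B\<bar>" using B[of t] t by (simp add: abs_le_iff)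
      also have "\<dots> = \<bar>B\<bar> / d * d" using d(1) by simp
      also have "\<dots> \<le> \<bar>B\<bar> / d * \<bar>t\<bar>" using d(1) False by (intro mult_left_mono) auto
      also have "\<dots> \<le> (1 + \<bar>B\<bar> / d) * \<bar>t\<bar>" by (intro mult_right_mono) auto
      finally show ?thesis .
    qed
    then show ?thesis using d(1) by (intro exI[of _ "1 + \<bar>B\<bar> / d"]) auto
  qed
  show ?thesis
  proof
    fix e :: real assume "e > 0"
    then obtain d where d: "d > 0" "\<And>t. t \<noteq> 0 \<Longrightarrow> \<bar>t\<bar> \<le> d \<Longrightarrow> \<bar>f t\<bar> \<le> e * \<bar>t\<bar>"
      using small_f by blast
    have "\<bar>primitive f t\<bar> \<le> e * t\<^sup>2" if t: "\<bar>t\<bar> \<le> d" for t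
    proof -
      obtain z where z: "\<bar>z\<bar> \<le> \<bar>t\<bar>" "\<bar>primitive f t\<bar> = \<bar>f z\<bar> * \<bar>t\<bar>"
        using mvt[of t 0] by (auto simp: primitive_0)
      have "\<bar>f z\<bar> \<le> e * \<bar>z\<bar>" using d(2)[of z] z(1) t f_0 by (cases "z = 0") auto
      also have "\<dots> \<le> e * \<bar>t\<bar>" using z(1) \<open>e > 0\<close> by simp
      finally have "\<bar>f z\<bar> * \<bar>t\<bar> \<le> e * \<bar>t\<bar> * \<bar>t\<bar>" by (rule mult_right_mono) simp
      then show ?thesis using z(2) by (simp add: power2_eq_square)
    qed
    then show "\<exists>d>0. \<forall>t. \<bar>t\<bar> \<le> d \<longrightarrow> \<bar>primitive f t\<bar> \<le> e * t\<^sup>2" using d(1) by blast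
  next
    fix M :: real
    obtain C where "C \<ge> 0" and C: "\<And>t. \<bar>t\<bar> \<le> M \<Longrightarrow> \<bar>f t\<bar> \<le> C * \<bar>t\<bar>" using bound by blast
    have "\<bar>primitive f s - primitive f t\<bar> \<le> C * max \<bar>s\<bar> \<bar>t\<bar> * \<bar>s - t\<bar>" if "\<bar>s\<bar> \<le> M" "\<bar>t\<bar> \<le> M" for s t
    proof -
      obtain z where z: "\<bar>z\<bar> \<le> max \<bar>s\<bar> \<bar>t\<bar>" "\<bar>primitive f s - primitive f t\<bar> = \<bar>f z\<bar> * \<bar>s - t\<bar>"
        using mvt by blast
      have "\<bar>f z\<bar> \<le> C * \<bar>z\<bar>" using C[of z] z(1) that by auto
      also have "\<dots> \<le> C * max \<bar>s\<bar> \<bar>t\<bar>" using z(1) \<open>C \<ge> 0\<close> by (rule mult_left_mono)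
      finally show ?thesis using z(2) by (simp add: mult_right_mono)
    qed
    then show "\<exists>C\<ge>0. \<forall>s t. \<bar>s\<bar> \<le> M \<longrightarrow> \<bar>t\<bar> \<le> M \<longrightarrow>
        \<bar>primitive f s - primitive f t\<bar> \<le> C * max \<bar>s\<bar> \<bar>t\<bar> * \<bar>s - t\<bar>"
      using \<open>C \<ge> 0\<close> by blast
  qed
qed


theorem theorem1p3:
  fixes f :: "real \<Rightarrow> real"
    and R :: "('n::finite lattice \<Rightarrow> real) \<Rightarrow> 'n lattice \<Rightarrow> real"
  assumes dim: "CARD('n) \<ge> 2"
    and f_cont: "continuous_on UNIV f"
    and f_lim: "((\<lambda>t. f t / t) \<longlongrightarrow> 0) (at 0)"
    and F_lim: "filterlim (\<lambda>t. primitive f t / \<bar>t\<bar> powr (2 + 4 / real CARD('n))) at_top (at 0)"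
  shows "(\<forall>m>0. - \<infinity> < min_energy TYPE('n) f m \<and> min_energy TYPE('n) f m < 0) \<and>
    (\<forall>m1>0. \<forall>m2>m1. min_energy TYPE('n) f m2 < min_energy TYPE('n) f m1) \<and>
    continuous_on {0<..} (min_energy TYPE('n) f) \<and>
    (schwarz_rearrangement R \<longrightarrow> (\<forall>t. primitive f t \<le> primitive f \<bar>t\<bar>) \<longrightarrow>
      (\<forall>m>0. \<exists>u \<in> mass_sphere m.
        ereal (energy f u) = min_energy TYPE('n) f m \<and>
        (\<forall>x. u x > 0) \<and> schwarz_symmetric R u))"
proof -
  interpret subquadratic "primitive f" "TYPE('n)"
    by (rule subquadratic_primitive[OF f_cont f_lim])
  have energy: "energy f u = J u" if "square_summable u" for u :: "'n lattice \<Rightarrow> real"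
    using infsumI[OF grad_norm_has_sum[OF that]] by (simp add: energy_def J_def)
  have min: "min_energy TYPE('n) f m = ereal (E m)" if "m \<ge> 0" for m
  proof -
    have "min_energy TYPE('n) f m = (INF u\<in>sphere m. ereal (J u))"
      unfolding min_energy_def mass_sphere_eq sphere_def by (rule INF_cong) (auto simp: energy)
    \<comment> \<open>The extended infimum is the real one because the set of values is non-empty
      and bounded below.\<close>
    also have "\<dots> = ereal (E m)"
      unfolding E_def using ereal_Inf'[OF bdd_below_J[of m]] sphere_nonempty[OF that]
      by (simp add: image_image)
    finally show ?thesis .
  qed
  have neg: "E m < 0" if "m > 0" for m
    by (rule E_negative[OF F_lim that])
  have "continuous_on {0<..} (\<lambda>m. ereal (E m))"
    by (intro continuous_on_ereal continuous_on_E)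
  then have "continuous_on {0<..} (min_energy TYPE('n) f)"
    by (rule continuous_on_eq) (simp add: min)
  moreover have "\<exists>u\<in>mass_sphere m. ereal (energy f u) = min_energy TYPE('n) f m \<and>
      (\<forall>x. u x > 0) \<and> schwarz_symmetric R u"
    if R: "schwarz_rearrangement R" and F: "\<forall>t. primitive f t \<le> primitive f \<bar>t\<bar>" and m: "m > 0" for m
  proof -
    obtain w where "square_summable w" "mass w = m" "J w = E m" "\<And>x. w x > 0" "schwarz_symmetric R w"
      using exists_symmetric_minimizer[OF neg m R] F by blast
    then show ?thesis
      using m by (intro bexI[of _ w]) (auto simp: mass_sphere_eq energy min)
  qed
  ultimately show ?thesis
    using neg E_strict_decreasing[OF neg] by (auto simp: min)
qed

end
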